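(* Let $z_1,z_2$ be distinct points on $\mathbb P$ (different from the base-point $P$) and $v_1,v_2\in\mathbf g$. The current operators $j^{v_1}(z_1)$ and $j^{v_2}(z_2)$ can be composed and commute. As $z_2\to z_1$ one has $$\begin{aligned} j^{v_2}(z_2)j^{v_1}(z_1)&+\frac{(v_1,v_2)\,du_{z_1}du_{z_2}}{(u(z_1)-u(z_2))^2}-\frac{1}{u(z_2)-u(z_1)}\,du_{z_2}\,j^{[v_2,v_1]}(z_1)\\ &\longrightarrow\ \iota^{v_2}(z_1)\iota^{v_1}(z_1)+\epsilon^{v_2}(z_1)\epsilon^{v_1}(z_1)+\epsilon^{v_2}(z_1)\iota^{v_1}(z_1)+\epsilon^{v_1}(z_1)\iota^{v_2}(z_1)+\frac{d\hat\iota^{[v_2,v_1]}}{dz}(z_1)\,du_{z_1}^2 .\end{aligned}$$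
   Context: $\mathbb P$ is a complex projective line with canonical bundle $K$ (fibre $K_z$ at $z$); $P\in\mathbb P$ is a fixed base-point and $u$ is a coordinate (meromorphic function with exactly one pole, which is simple) with its pole at $P$. $\mathbf g$ is a complex Lie algebra with a nondegenerate invariant symmetric bilinear form $(\cdot,\cdot)$. $\mathfrak g_-$ is the Lie algebra of meromorphic maps $\alpha:\mathbb P\to\mathbf g$ regular and vanishing at $P$; $\mathfrak g_-^{z}$ and $\mathfrak g_-^{z_1,z_2}$ are the subalgebras of those that are moreover regular at $z$, respectively at $z_1$ and $z_2$. $U$ denotes the universal enveloping algebra, and $\mathbf 1=1\in\mathbb C\subset U\mathfrak g_-$. For $v\in\mathbf g$ and $z\ne P$: $\epsilon^v(z):U\mathfrak g_-\to U\mathfrak g_-\otimes K_z$ is left multiplication by $\epsilon^v_z=\frac{v}{u-u(z)}\otimes du_z$; and $\iota^v(z):U\mathfrak g_-^z\to U\mathfrak g_-^z\otimes K_z$ is defined inductively (simultaneously for all $v$) by $\iota^v(z)\mathbf 1=0$ and, for $\alpha\in\mathfrak g_-^z$ acting by left multiplication, $$\iota^v(z)\circ\alpha-\alpha\circ\iota^v(z)=-[\epsilon^v(z),\alpha]-(v,d\alpha(z))+\iota^{[v,\alpha(z)]}(z)+\epsilon^{[v,\alpha(z)]}(z).$$ The current is $j^v(z)=\epsilon^v(z)+\iota^v(z):U\mathfrak g_-^z\to U\mathfrak g_-\otimes K_z$. One writes $\iota^v(z)=\hat\iota^v(z)\,du_z$, and $d\hat\iota^v/dz$ is the derivative with respect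 to the coordinate $u(z)$. The factors $du_{z_1},du_{z_2}$ commute with each other and with everything else without signs. Products of currents at $z_1\ne z_2$ are composed on $U\mathfrak g_-^{z_1,z_2}$; the limit is taken after applying the operators to a fixed vector of $U\mathfrak g_-^{z_1}$, for which the products are defined when $z_2\neq z_1$ is near $z_1$.
   Formalization: The central term (v_1,v_2)du_{z_1}du_{z_2}/(u(z_1)-u(z_2))^2 is subtracted rather than added: with the recursion's term -(v,dα(z)), the printed plus sign leaves a divergent 2(v_1,v_2)/(u(z_1)-u(z_2))^2 when applied to 1 whenever (v_1,v_2)≠0. *)

theory Defs
  imports "HOL-Complex_Analysis.Complex_Analysis"
begin

text \<open>
  The coordinate \<open>u\<close> identifies the projective line, with its base-point \<open>P\<close> removed, with the
  complex plane: a point \<open>z \<noteq> P\<close> is represented by the number \<open>u(z) :: complex\<close>, and \<open>P\<close> is the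
  point at infinity.  The line \<open>K_z\<close> has basis \<open>du_z\<close>; every operator with values in
  \<open>_ \<otimes> K_z\<close> is represented by its coefficient with respect to \<open>du_z\<close>, and a product of operators
  at \<open>z1\<close>, \<open>z2\<close> by its coefficient with respect to \<open>du_{z1} du_{z2}\<close>.
\<close>

section \<open>Complex Lie algebras\<close>

class complex_vec = ab_group_add +
  fixes scaleC :: "complex \<Rightarrow> 'a \<Rightarrow> 'a"  (infixr "*\<^sub>C" 75)
  assumes scaleC_add_right: "a *\<^sub>C (x + y) = a *\<^sub>C x + a *\<^sub>C y"
    and scaleC_add_left: "(a + b) *\<^sub>C x = a *\<^sub>C x + b *\<^sub>C x"
    and scaleC_scaleC: "a *\<^sub>C (b *\<^sub>C x) = (a * b) *\<^sub>C x"
    and scaleC_one: "1 *\<^sub>C x = x"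

class complex_lie_algebra = complex_vec +
  fixes lie :: "'a \<Rightarrow> 'a \<Rightarrow> 'a"
  assumes lie_add_left: "lie (x + y) z = lie x z + lie y z"
    and lie_add_right: "lie x (y + z) = lie x y + lie x z"
    and lie_scaleC_left: "lie (c *\<^sub>C x) y = c *\<^sub>C lie x y"
    and lie_scaleC_right: "lie x (c *\<^sub>C y) = c *\<^sub>C lie x y"
    and lie_self: "lie x x = 0"
    and lie_jacobi: "lie x (lie y z) + lie y (lie z x) + lie z (lie x y) = 0"

class metric_lie_algebra = complex_lie_algebra +
  fixes form :: "'a \<Rightarrow> 'a \<Rightarrow> complex"
  assumes form_add_left: "form (x + y) z = form x z + form y z"
    and form_scaleC_left: "form (c *\<^sub>C x) y = c * form x y"
    and form_sym: "form x y = form y x"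
    and form_invariant: "form (lie x y) z = form x (lie y z)"
    and form_nondegenerate: "(\<And>y. form x y = 0) \<Longrightarrow> x = 0"

lemma scaleC_zero_right [simp]: "a *\<^sub>C (0::'a::complex_vec) = 0"
  using scaleC_add_right[of a "0::'a" 0] by simp

lemma scaleC_zero_left [simp]: "0 *\<^sub>C (x::'a::complex_vec) = 0"
  using scaleC_add_left[of 0 0 x] by simp

lemma scaleC_minus_one: "(-1) *\<^sub>C (x::'a::complex_vec) = - x"
  using scaleC_add_left[of "-1" 1 x] by (simp add: scaleC_one eq_neg_iff_add_eq_0)

section \<open>The universal enveloping algebra\<close>

text \<open>
  The unital associative complex algebra presented by generators \<open>Gen x\<close> (\<open>x\<close> in the Lie algebra)
  and the relations saying that \<open>Gen\<close> is linear and takes brackets to commutators.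
\<close>

datatype 'l uea_term =
  TScal complex | TGen 'l | TAdd "'l uea_term" "'l uea_term" | TMul "'l uea_term" "'l uea_term"

inductive uea_eq :: "'l::complex_lie_algebra uea_term \<Rightarrow> 'l uea_term \<Rightarrow> bool" where
  refl: "uea_eq s s"
| sym: "uea_eq s t \<Longrightarrow> uea_eq t s"
| trans: "uea_eq s t \<Longrightarrow> uea_eq t r \<Longrightarrow> uea_eq s r"
| add_cong: "uea_eq s s' \<Longrightarrow> uea_eq t t' \<Longrightarrow> uea_eq (TAdd s t) (TAdd s' t')"
| mul_cong: "uea_eq s s' \<Longrightarrow> uea_eq t t' \<Longrightarrow> uea_eq (TMul s t) (TMul s' t')"
| add_assoc: "uea_eq (TAdd (TAdd r s) t) (TAdd r (TAdd s t))"
| add_comm: "uea_eq (TAdd s t) (TAdd t s)"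
| add_zero: "uea_eq (TAdd (TScal 0) s) s"
| add_inverse: "uea_eq (TAdd (TMul (TScal (-1)) s) s) (TScal 0)"
| mul_assoc: "uea_eq (TMul (TMul r s) t) (TMul r (TMul s t))"
| mul_one: "uea_eq (TMul (TScal 1) s) s"
| distrib_left: "uea_eq (TMul r (TAdd s t)) (TAdd (TMul r s) (TMul r t))"
| distrib_right: "uea_eq (TMul (TAdd r s) t) (TAdd (TMul r t) (TMul s t))"
| scal_add: "uea_eq (TScal (a + b)) (TAdd (TScal a) (TScal b))"
| scal_mul: "uea_eq (TScal (a * b)) (TMul (TScal a) (TScal b))"
| scal_central: "uea_eq (TMul (TScal a) s) (TMul s (TScal a))"
| gen_add: "uea_eq (TGen (x + y)) (TAdd (TGen x) (TGen y))"
| gen_scaleC: "uea_eq (TGen (a *\<^sub>C x)) (TMul (TScal a) (TGen x))"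
| gen_lie: "uea_eq (TMul (TGen x) (TGen y)) (TAdd (TMul (TGen y) (TGen x)) (TGen (lie x y)))"

quotient_type (overloaded) 'l uea = "'l::complex_lie_algebra uea_term" / uea_eq
  by (rule equivpI) (auto intro: reflpI sympI transpI uea_eq.refl uea_eq.sym uea_eq.trans)

lift_definition Gen :: "'l::complex_lie_algebra \<Rightarrow> 'l uea" is TGen .

text \<open>The counit, needed here only to see that \<open>0 \<noteq> 1\<close>.\<close>

primrec uea_term_counit :: "'l uea_term \<Rightarrow> complex" where
  "uea_term_counit (TScal c) = c"
| "uea_term_counit (TGen x) = 0"
| "uea_term_counit (TAdd s t) = uea_term_counit s + uea_term_counit t"
| "uea_term_counit (TMul s t) = uea_term_counit s * uea_term_counit t"

lemma uea_term_counit_cong: "uea_eq s t \<Longrightarrow> uea_term_counit s = uea_term_counit t"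
  by (induction rule: uea_eq.induct) (auto simp: algebra_simps)

instantiation uea :: (complex_lie_algebra) ring_1
begin

lift_definition zero_uea :: "'a uea" is "TScal 0" .
lift_definition one_uea :: "'a uea" is "TScal 1" .
lift_definition plus_uea :: "'a uea \<Rightarrow> 'a uea \<Rightarrow> 'a uea" is TAdd by (rule uea_eq.add_cong)
lift_definition times_uea :: "'a uea \<Rightarrow> 'a uea \<Rightarrow> 'a uea" is TMul by (rule uea_eq.mul_cong)
lift_definition uminus_uea :: "'a uea \<Rightarrow> 'a uea" is "TMul (TScal (-1))"
  by (rule uea_eq.mul_cong[OF uea_eq.refl])
definition minus_uea :: "'a uea \<Rightarrow> 'a uea \<Rightarrow> 'a uea" where "minus_uea x y = x + (- y)"

instance
proof
  fix a b c :: "'a uea"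
  show "a + b + c = a + (b + c)" by transfer (rule uea_eq.add_assoc)
  show "a + b = b + a" by transfer (rule uea_eq.add_comm)
  show "0 + a = a" by transfer (rule uea_eq.add_zero)
  show "- a + a = 0" by transfer (rule uea_eq.add_inverse)
  show "a - b = a + - b" by (rule minus_uea_def)
  show "a * b * c = a * (b * c)" by transfer (rule uea_eq.mul_assoc)
  show "1 * a = a" by transfer (rule uea_eq.mul_one)
  show "a * 1 = a" by transfer (rule uea_eq.trans[OF uea_eq.sym[OF uea_eq.scal_central] uea_eq.mul_one])
  show "(a + b) * c = a * c + b * c" by transfer (rule uea_eq.distrib_right)
  show "a * (b + c) = a * b + a * c" by transfer (rule uea_eq.distrib_left)
  show "(0::'a uea) \<noteq> 1" by transfer (use uea_term_counit_cong in fastforce)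
qed

end

instantiation uea :: (complex_lie_algebra) complex_vec
begin

lift_definition scaleC_uea :: "complex \<Rightarrow> 'a uea \<Rightarrow> 'a uea" is "\<lambda>c. TMul (TScal c)"
  by (rule uea_eq.mul_cong[OF uea_eq.refl])

instance
proof
  fix a b :: complex and x y :: "'a uea"
  show "a *\<^sub>C (x + y) = a *\<^sub>C x + a *\<^sub>C y" by transfer (rule uea_eq.distrib_left)
  show "(a + b) *\<^sub>C x = a *\<^sub>C x + b *\<^sub>C x"
    by transfer (rule uea_eq.trans[OF uea_eq.mul_cong[OF uea_eq.scal_add uea_eq.refl] uea_eq.distrib_right])
  show "a *\<^sub>C (b *\<^sub>C x) = (a * b) *\<^sub>C x"
    by transfer
      (rule uea_eq.sym[OF uea_eq.trans[OF uea_eq.mul_cong[OF uea_eq.scal_mul uea_eq.refl] uea_eq.mul_assoc]])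
  show "1 *\<^sub>C x = x" by transfer (rule uea_eq.mul_one)
qed

end

lemma Gen_add: "Gen (x + y) = Gen x + Gen y"
  by transfer (rule uea_eq.gen_add)

lemma Gen_scaleC: "Gen (c *\<^sub>C x) = c *\<^sub>C Gen x"
  by transfer (rule uea_eq.gen_scaleC)

lemma Gen_lie: "Gen (lie x y) = Gen x * Gen y - Gen y * Gen x"
proof -
  have "Gen x * Gen y = Gen y * Gen x + Gen (lie x y)"
    by transfer (rule uea_eq.gen_lie)
  then show ?thesis by simp
qed

text \<open>
  For a Lie subalgebra \<open>S\<close> of \<open>L\<close>, the enveloping algebra of \<open>S\<close> is identified, as usual, with the
  subalgebra of the enveloping algebra of \<open>L\<close> generated by \<open>S\<close>.
\<close>

inductive_set uea_sub :: "'l::complex_lie_algebra set \<Rightarrow> 'l uea set" for S where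
  scal: "c *\<^sub>C 1 \<in> uea_sub S"
| gen: "x \<in> S \<Longrightarrow> Gen x \<in> uea_sub S"
| add: "a \<in> uea_sub S \<Longrightarrow> b \<in> uea_sub S \<Longrightarrow> a + b \<in> uea_sub S"
| mul: "a \<in> uea_sub S \<Longrightarrow> b \<in> uea_sub S \<Longrightarrow> a * b \<in> uea_sub S"

section \<open>Meromorphic maps from the projective line to a Lie algebra\<close>

text \<open>Scalar meromorphic functions on the projective line that are regular and vanish at \<open>P\<close>.\<close>

definition mero_vanishing :: "(complex \<Rightarrow> complex) set" where
  "mero_vanishing = {c. c meromorphic_on UNIV \<and> (\<lambda>t. c (inverse t)) meromorphic_on {0} \<and>
     (c \<longlongrightarrow> 0) at_infinity}"

text \<open>
  No topology is given on the Lie algebra (which may have infinite dimension): a vector-valued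
  function of a given kind is a finite sum of scalar functions of that kind times fixed vectors.
\<close>

inductive_set vec_fun :: "(complex \<Rightarrow> complex) set \<Rightarrow> (complex \<Rightarrow> 'g::complex_vec) set" for C where
  pure: "c \<in> C \<Longrightarrow> (\<lambda>u. c u *\<^sub>C v) \<in> vec_fun C"
| add: "f \<in> vec_fun C \<Longrightarrow> g \<in> vec_fun C \<Longrightarrow> (\<lambda>u. f u + g u) \<in> vec_fun C"

text \<open>Meromorphic maps are identified when they agree off a finite set.\<close>

definition mero_rel :: "(complex \<Rightarrow> 'g::complex_vec) \<Rightarrow> (complex \<Rightarrow> 'g) \<Rightarrow> bool" where
  "mero_rel f g \<longleftrightarrow> f \<in> vec_fun mero_vanishing \<and> g \<in> vec_fun mero_vanishing \<and> finite {u. f u \<noteq> g u}"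

lemma zero_mero_vanishing: "(\<lambda>u. 0) \<in> mero_vanishing"
  by (auto simp: mero_vanishing_def intro!: meromorphic_intros)

lemma mult_mero_vanishing:
  assumes "c \<in> mero_vanishing" "d \<in> mero_vanishing"
  shows "(\<lambda>u. c u * d u) \<in> mero_vanishing"
  using assms tendsto_mult[of c 0 at_infinity d 0]
  by (auto simp: mero_vanishing_def intro!: meromorphic_intros)

lemma const_mult_mero_vanishing:
  assumes "d \<in> mero_vanishing"
  shows "(\<lambda>u. a * d u) \<in> mero_vanishing"
  using assms tendsto_mult[of "\<lambda>_. a" a at_infinity d 0]
  by (auto simp: mero_vanishing_def intro!: meromorphic_intros)

lemma zero_vec_fun: "(\<lambda>u. 0) \<in> vec_fun mero_vanishing"
  using vec_fun.pure[OF zero_mero_vanishing, of 0] by simp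

lemma scaleC_vec_fun:
  "f \<in> vec_fun mero_vanishing \<Longrightarrow> (\<lambda>u. a *\<^sub>C f u) \<in> vec_fun mero_vanishing"
  by (induction rule: vec_fun.induct)
    (auto simp: scaleC_add_right scaleC_scaleC intro: vec_fun.intros const_mult_mero_vanishing)

lemma lie_vec_fun:
  assumes "f \<in> vec_fun mero_vanishing" "g \<in> vec_fun mero_vanishing"
  shows "(\<lambda>u. lie (f u) (g u)) \<in> vec_fun mero_vanishing"
  using assms
proof (induction rule: vec_fun.induct)
  case (pure c v)
  note c = pure.hyps
  from pure.prems show ?case
    by (induction rule: vec_fun.induct)
      (auto simp: lie_add_right lie_scaleC_left lie_scaleC_right scaleC_add_right scaleC_scaleC
         intro!: vec_fun.intros mult_mero_vanishing c)
qed (auto simp: lie_add_left intro: vec_fun.add)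

lemma finite_neq_trans:
  "finite {u. f u \<noteq> g u} \<Longrightarrow> finite {u. g u \<noteq> h u} \<Longrightarrow> finite {u. f u \<noteq> h u}"
  by (rule finite_subset[of _ "{u. f u \<noteq> g u} \<union> {u. g u \<noteq> h u}"]) auto

text \<open>The Lie algebra of meromorphic maps to \<open>'g\<close> that are regular and vanish at \<open>P\<close>.\<close>

quotient_type (overloaded) 'g gminus = "complex \<Rightarrow> 'g::complex_vec" / partial: mero_rel
proof (rule part_equivpI)
  show "\<exists>f. mero_rel f (f :: complex \<Rightarrow> 'g)"
    by (auto simp: mero_rel_def intro!: exI[of _ "\<lambda>_. 0"] zero_vec_fun)
  show "symp (mero_rel :: (complex \<Rightarrow> 'g) \<Rightarrow> _)"
    by (auto simp: mero_rel_def eq_commute intro!: sympI)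
  show "transp (mero_rel :: (complex \<Rightarrow> 'g) \<Rightarrow> _)"
    by (auto simp: mero_rel_def intro!: transpI elim: finite_neq_trans)
qed

lemma mero_rel_lift2:
  assumes "mero_rel f f'" "mero_rel g g'"
    and "(\<lambda>u. h (f u) (g u)) \<in> vec_fun mero_vanishing" "(\<lambda>u. h (f' u) (g' u)) \<in> vec_fun mero_vanishing"
  shows "mero_rel (\<lambda>u. h (f u) (g u)) (\<lambda>u. h (f' u) (g' u))"
  using assms unfolding mero_rel_def
  by (auto intro: finite_subset[of _ "{u. f u \<noteq> f' u} \<union> {u. g u \<noteq> g' u}"])

instantiation gminus :: (complex_vec) complex_vec
begin

lift_definition zero_gminus :: "'a gminus" is "\<lambda>_. 0"
  by (auto simp: mero_rel_def zero_vec_fun)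
lift_definition plus_gminus :: "'a gminus \<Rightarrow> 'a gminus \<Rightarrow> 'a gminus" is "\<lambda>f g u. f u + g u"
  by (rule mero_rel_lift2) (auto simp: mero_rel_def intro: vec_fun.add)
lift_definition scaleC_gminus :: "complex \<Rightarrow> 'a gminus \<Rightarrow> 'a gminus" is "\<lambda>a f u. a *\<^sub>C f u"
  by (rule mero_rel_lift2[where h = "\<lambda>x y. _ *\<^sub>C x"]) (auto simp: mero_rel_def intro: scaleC_vec_fun)
definition uminus_gminus :: "'a gminus \<Rightarrow> 'a gminus" where "uminus_gminus x = (-1) *\<^sub>C x"
definition minus_gminus :: "'a gminus \<Rightarrow> 'a gminus \<Rightarrow> 'a gminus" where "minus_gminus x y = x + (- y)"

instance
proof
  fix a b c :: "'a gminus" and r s :: complex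
  show "a + b + c = a + (b + c)"
    by transfer (auto simp: mero_rel_def add.assoc intro!: vec_fun.add)
  show "a + b = b + a"
    by transfer (auto simp: mero_rel_def add.commute intro!: vec_fun.add)
  show "0 + a = a"
    by transfer (auto simp: mero_rel_def)
  show "- a + a = 0" unfolding uminus_gminus_def
    by transfer (auto simp: mero_rel_def scaleC_minus_one zero_vec_fun)
  show "a - b = a + - b" by (rule minus_gminus_def)
  show "r *\<^sub>C (a + b) = r *\<^sub>C a + r *\<^sub>C b"
    by transfer (auto simp: mero_rel_def scaleC_add_right intro!: vec_fun.add scaleC_vec_fun)
  show "(r + s) *\<^sub>C a = r *\<^sub>C a + s *\<^sub>C a"
    by transfer (auto simp: mero_rel_def scaleC_add_left intro!: vec_fun.add scaleC_vec_fun)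
  show "r *\<^sub>C (s *\<^sub>C a) = (r * s) *\<^sub>C a"
    by transfer (auto simp: mero_rel_def scaleC_scaleC intro!: scaleC_vec_fun)
  show "1 *\<^sub>C a = a"
    by transfer (auto simp: mero_rel_def scaleC_one)
qed

end

instantiation gminus :: (complex_lie_algebra) complex_lie_algebra
begin

lift_definition lie_gminus :: "'a gminus \<Rightarrow> 'a gminus \<Rightarrow> 'a gminus" is "\<lambda>f g u. lie (f u) (g u)"
  by (rule mero_rel_lift2) (auto simp: mero_rel_def intro: lie_vec_fun)

instance
proof
  fix x y z :: "'a gminus" and c :: complex
  show "lie (x + y) z = lie x z + lie y z"
    by transfer (auto simp: mero_rel_def lie_add_left intro!: vec_fun.add lie_vec_fun)
  show "lie x (y + z) = lie x y + lie x z"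
    by transfer (auto simp: mero_rel_def lie_add_right intro!: vec_fun.add lie_vec_fun)
  show "lie (c *\<^sub>C x) y = c *\<^sub>C lie x y"
    by transfer (auto simp: mero_rel_def lie_scaleC_left intro!: scaleC_vec_fun lie_vec_fun)
  show "lie x (c *\<^sub>C y) = c *\<^sub>C lie x y"
    by transfer (auto simp: mero_rel_def lie_scaleC_right intro!: scaleC_vec_fun lie_vec_fun)
  show "lie x x = 0"
    by transfer (auto simp: mero_rel_def lie_self zero_vec_fun)
  show "lie x (lie y z) + lie y (lie z x) + lie z (lie x y) = 0"
    by transfer (auto simp: mero_rel_def lie_jacobi zero_vec_fun)
qed

end

text \<open>
  \<open>regular_rep z \<alpha> f\<close>: the function \<open>f\<close> represents \<open>\<alpha>\<close> and is holomorphic near \<open>z\<close>.  Two such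
  representatives agree near \<open>z\<close>, so that value and derivative at \<open>z\<close> do not depend on the choice.
\<close>

definition regular_rep :: "complex \<Rightarrow> 'g::complex_vec gminus \<Rightarrow> (complex \<Rightarrow> 'g) \<Rightarrow> bool" where
  "regular_rep z \<alpha> f \<longleftrightarrow> f \<in> vec_fun mero_vanishing \<and> \<alpha> = abs_gminus f \<and>
     f \<in> vec_fun {c. c analytic_on {z}}"

definition regular_at :: "complex \<Rightarrow> 'g::complex_vec gminus \<Rightarrow> bool" where
  "regular_at z \<alpha> \<longleftrightarrow> (\<exists>f. regular_rep z \<alpha> f)"

definition value_at :: "complex \<Rightarrow> 'g::complex_vec gminus \<Rightarrow> 'g" where
  "value_at z \<alpha> = (SOME f. regular_rep z \<alpha> f) z"

text \<open>The coefficient of \<open>(v, d\<alpha>(z))\<close>.\<close>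

definition form_deriv_at :: "complex \<Rightarrow> 'g::metric_lie_algebra \<Rightarrow> 'g gminus \<Rightarrow> complex" where
  "form_deriv_at z v \<alpha> = deriv (\<lambda>u. form v ((SOME f. regular_rep z \<alpha> f) u)) z"

text \<open>The enveloping algebra of the subalgebra of maps that are regular at all points of \<open>Z\<close>.\<close>

definition U_reg :: "complex set \<Rightarrow> 'g::complex_lie_algebra gminus uea set" where
  "U_reg Z = uea_sub {\<alpha>. \<forall>z\<in>Z. regular_at z \<alpha>}"

section \<open>Currents\<close>

definition pure_map :: "(complex \<Rightarrow> complex) \<Rightarrow> 'g::complex_vec \<Rightarrow> 'g gminus" where
  "pure_map c v = abs_gminus (\<lambda>u. c u *\<^sub>C v)"

definition eps :: "complex \<Rightarrow> 'g::complex_vec \<Rightarrow> 'g gminus" where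
  "eps z v = pure_map (\<lambda>u. 1 / (u - z)) v"

definition epsilon :: "complex \<Rightarrow> 'g::complex_lie_algebra \<Rightarrow> 'g gminus uea \<Rightarrow> 'g gminus uea" where
  "epsilon z v x = Gen (eps z v) * x"

text \<open>
  The recursion that defines \<open>\<iota>\<close>.  The last clause makes the family unique as a total function;
  the operators are only meaningful on \<open>U_reg {z}\<close>.
\<close>

definition iota_family ::
    "complex \<Rightarrow> ('g::metric_lie_algebra \<Rightarrow> 'g gminus uea \<Rightarrow> 'g gminus uea) \<Rightarrow> bool" where
  "iota_family z I \<longleftrightarrow>
     (\<forall>v. \<forall>x\<in>U_reg {z}. I v x \<in> U_reg {z}) \<and>
     (\<forall>v. \<forall>x\<in>U_reg {z}. \<forall>y\<in>U_reg {z}. I v (x + y) = I v x + I v y) \<and>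
     (\<forall>v c. \<forall>x\<in>U_reg {z}. I v (c *\<^sub>C x) = c *\<^sub>C I v x) \<and>
     (\<forall>v. I v 1 = 0) \<and>
     (\<forall>v \<alpha>. regular_at z \<alpha> \<longrightarrow> (\<forall>x\<in>U_reg {z}.
        I v (Gen \<alpha> * x) - Gen \<alpha> * I v x =
          - (Gen (lie (eps z v) \<alpha>) * x) - form_deriv_at z v \<alpha> *\<^sub>C x
          + I (lie v (value_at z \<alpha>)) x + epsilon z (lie v (value_at z \<alpha>)) x)) \<and>
     (\<forall>v x. x \<notin> U_reg {z} \<longrightarrow> I v x = 0)"

definition iota :: "complex \<Rightarrow> 'g::metric_lie_algebra \<Rightarrow> 'g gminus uea \<Rightarrow> 'g gminus uea" where
  "iota z = (THE I. iota_family z I)"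

text \<open>
  A consequence of the sign of \<open>form_deriv_at\<close> above: since \<open>d(1/(u-z1))/du = -1/(u-z1)^2\<close>, moving
  the current at \<open>z2\<close> past \<open>epsilon z1 v1\<close> produces the scalar \<open>+ form v2 v1 / (z2-z1)^2\<close>.  This
  double pole has to be subtracted from the product of two currents to make it finite at \<open>z2 = z1\<close>.
\<close>

definition current :: "complex \<Rightarrow> 'g::metric_lie_algebra \<Rightarrow> 'g gminus uea \<Rightarrow> 'g gminus uea" where
  "current z v x = epsilon z v x + iota z v x"

section \<open>Limits in the enveloping algebra\<close>

text \<open>
  A family of scalar meromorphic functions converges when it does so locally uniformly off a finite
  set of points (so a pole may move, as in \<open>1/(u-w) \<longlonglongrightarrow> 1/(u-z)\<close> for \<open>w \<longlonglongrightarrow> z\<close>).  The sets \<open>- N\<close>,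
  together with \<open>P\<close>, are compact in the projective line.
\<close>

definition mero_tendsto ::
    "('i \<Rightarrow> complex \<Rightarrow> complex) \<Rightarrow> (complex \<Rightarrow> complex) \<Rightarrow> 'i filter \<Rightarrow> bool" where
  "mero_tendsto c l F \<longleftrightarrow>
     (\<forall>w. c w \<in> mero_vanishing) \<and> l \<in> mero_vanishing \<and>
     (\<exists>S. finite S \<and> (\<forall>N. open N \<and> S \<subseteq> N \<longrightarrow>
        (\<forall>\<^sub>F w in F. c w analytic_on (- N)) \<and> l analytic_on (- N) \<and> uniform_limit (- N) c l F))"

text \<open>
  The limit in the enveloping algebra is the one induced by the above: a family converges if it can
  be written as a fixed finite expression (sums and products) in convergent families of scalars and
  of generators.  This is the strongest notion of limit for which addition and multiplication are
  continuous and the inclusions of the scalars and of the maps \<open>c v\<close> (\<open>c\<close> scalar, \<open>v\<close> a vector)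
  are; it implies convergence in any topology on the algebra with these properties.  Limits along
  a nontrivial filter are unique: expanding at \<open>P\<close> sends such a family to one that converges in a
  finite-dimensional subspace of the enveloping algebra of \<open>t g[t] / t^n g[t]\<close>, for every \<open>n\<close>, and
  these expansions jointly separate points.
\<close>

inductive uea_tendsto ::
    "'i filter \<Rightarrow> ('i \<Rightarrow> 'g::complex_lie_algebra gminus uea) \<Rightarrow> 'g gminus uea \<Rightarrow> bool"
  for F :: "'i filter" where
  scal: "(c \<longlongrightarrow> l) F \<Longrightarrow> uea_tendsto F (\<lambda>w. c w *\<^sub>C 1) (l *\<^sub>C 1)"
| gen: "mero_tendsto c l F \<Longrightarrow> uea_tendsto F (\<lambda>w. Gen (pure_map (c w) v)) (Gen (pure_map l v))"
| add: "uea_tendsto F f a \<Longrightarrow> uea_tendsto F g b \<Longrightarrow> uea_tendsto F (\<lambda>w. f w + g w) (a + b)"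
| mul: "uea_tendsto F f a \<Longrightarrow> uea_tendsto F g b \<Longrightarrow> uea_tendsto F (\<lambda>w. f w * g w) (a * b)"
| cong: "uea_tendsto F f a \<Longrightarrow> (\<forall>\<^sub>F w in F. f w = g w) \<Longrightarrow> uea_tendsto F g a"

text \<open>\<open>d\<close> is the value at \<open>x\<close> of the derivative of \<open>\<iota>\<close>, with respect to the coordinate, at \<open>z\<close>.\<close>

definition iota_has_deriv ::
    "complex \<Rightarrow> 'g::metric_lie_algebra \<Rightarrow> 'g gminus uea \<Rightarrow> 'g gminus uea \<Rightarrow> bool" where
  "iota_has_deriv z v x d \<longleftrightarrow>
     uea_tendsto (at z) (\<lambda>w. (1 / (w - z)) *\<^sub>C (iota w v x - iota z v x)) d"

end

theory Submission
  imports Defs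
begin

text \<open>
  The operators are well defined because the current \<open>j v\<close> at \<open>z\<close> is a restriction of a map that is
  defined on the whole enveloping algebra \<open>U L\<close>, where \<open>L\<close> is the Lie algebra of meromorphic maps
  vanishing at \<open>P\<close>.  Consider the extension \<open>L + \<complex>\<close> of the adjoint module by the negative of the residue
  cocycle \<open>res_pairing z\<close>, and the module of linear maps from it to \<open>U L\<close>.  By the universal
  property of \<open>U L\<close>, acting on one such map \<open>p\<close> gives linear maps \<open>D X\<close> on \<open>U L\<close> with \<open>D X 1 = p X\<close> and
  a prescribed commutator with left multiplications (\<open>uea_recursion\<close>).  Let \<open>p X\<close> be \<open>eps z y\<close>, where
  \<open>y\<close> is the vector residue of \<open>X\<close> at \<open>z\<close>.  Then \<open>D X\<close> vanishes on \<open>U_reg {z}\<close> when \<open>X\<close> is regular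
  at \<open>z\<close>, and \<open>D (eps z v)\<close> satisfies the commutation rule of the current there
  (\<open>ex_local_action\<close>).  In effect, \<open>eps z v\<close> acts as a local element placed at \<open>z\<close> alone.
  Subtracting left multiplication by \<open>eps z v\<close> gives \<open>\<iota>\<close>.  Since \<open>D\<close> exists on all of \<open>U L\<close>, relations
  between words in regular elements need no separate consideration, and the theorem of
  Poincare, Birkhoff and Witt is not used.

  All further statements are proved by induction along words in regular elements
  (\<open>U_reg_word_induct\<close>).  For the commutation of two currents, the commutator of each with a
  generator is again a current plus a scalar, so that only the vector \<open>1\<close> requires a computation, in
  which \<open>lie_eps_eps\<close> (partial fractions) makes the two sides agree.  For the expansion, moving
  \<open>\<iota>\<close> at \<open>z2\<close> past \<open>eps z1 v1\<close> shows that the left-hand side equals, for \<open>z2 \<noteq> z1\<close>, the expected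
  limit with \<open>z2\<close> in place of \<open>z1\<close> in the operators coming from the second current, plus the
  difference quotient of \<open>\<iota>\<close> (\<open>current_product\<close>).
  It remains to see that \<open>\<iota>\<close> is differentiable in the point, which again follows along words from a
  product rule and from the differentiability of \<open>1 / (u - w)\<close> in \<open>w\<close>
  (\<open>uea_differentiable_iota\<close>).
\<close>

section \<open>Linear recursion on an enveloping algebra\<close>

lemma scaleC_diff_right: "a *\<^sub>C (x - y) = a *\<^sub>C x - a *\<^sub>C (y::'a::complex_vec)"
  using scaleC_add_right[of a "x - y" y] by simp

lemma scaleC_diff_left: "(a - b) *\<^sub>C x = a *\<^sub>C x - b *\<^sub>C (x::'a::complex_vec)"
  using scaleC_add_left[of "a - b" b x] by simp

lemma scaleC_minus_left: "(- a) *\<^sub>C x = - (a *\<^sub>C (x::'a::complex_vec))"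
  using scaleC_diff_left[of 0 a x] by simp

lemma lie_minus_right: "lie x (- y) = - lie x (y::'a::complex_lie_algebra)"
  using lie_scaleC_right[of x "-1" y] by (simp add: scaleC_minus_one)

lemma lie_diff_right: "lie x (y - z) = lie x y - lie x (z::'a::complex_lie_algebra)"
  using lie_add_right[of x y "- z"] by (simp add: lie_minus_right)

lemma lie_anticomm: "lie x y = - lie y (x::'a::complex_lie_algebra)"
proof -
  have "lie (x + y) (x + y) = lie y x + lie x y"
    by (simp only: lie_add_left lie_add_right) (simp add: lie_self)
  then show ?thesis
    by (simp only: lie_self) (simp add: eq_neg_iff_add_eq_0 add.commute)
qed

lemma lie_derivation: "lie x (lie a b) = lie (lie x a) b - lie (lie x b) (a::'a::complex_lie_algebra)"
  using lie_jacobi[of x a b] lie_anticomm[of a "lie b x"] lie_anticomm[of b "lie x a"]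
    lie_anticomm[of b x] lie_minus_right[of a "lie x b"] lie_anticomm[of a "lie x b"]
  by (simp add: algebra_simps)

lemma uea_scaleC_mult_left: "(c *\<^sub>C x) * y = c *\<^sub>C (x * (y::'l::complex_lie_algebra uea))"
  by transfer (rule uea_eq.mul_assoc)

lemma uea_scaleC_mult_right: "x * (c *\<^sub>C y) = c *\<^sub>C (x * (y::'l::complex_lie_algebra uea))"
  by transfer (meson uea_eq.mul_assoc uea_eq.mul_cong uea_eq.refl uea_eq.scal_central uea_eq.sym
      uea_eq.trans)

lemma abs_uea_TScal: "abs_uea (TScal c) = c *\<^sub>C (1::'l::complex_lie_algebra uea)"
proof -
  have "uea_eq (TScal c :: 'l uea_term) (TMul (TScal c) (TScal 1))"
    using uea_eq.scal_mul[of c 1] by simp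
  then show ?thesis
    by (simp add: one_uea.abs_eq scaleC_uea.abs_eq uea.abs_eq_iff)
qed

lemma Gen_minus: "Gen (- x) = - Gen (x::'l::complex_lie_algebra)"
  using Gen_scaleC[of "-1" x] by (simp add: scaleC_minus_one)

lemma Gen_diff: "Gen (x - y) = Gen x - Gen (y::'l::complex_lie_algebra)"
  using Gen_add[of x "- y"] by (simp add: Gen_minus)

lemma Gen_zero [simp]: "Gen (0::'l::complex_lie_algebra) = 0"
  using Gen_add[of "0::'l" 0] by simp

text \<open>Words in the elements of \<open>S\<close> span \<open>uea_sub S\<close>.\<close>

lemma uea_sub_word_induct [consumes 1, case_names one add scaleC word]:
  fixes S :: "'l::complex_lie_algebra set"
  assumes x: "x \<in> uea_sub S"
    and one: "P 1"
    and add: "\<And>x y. x \<in> uea_sub S \<Longrightarrow> y \<in> uea_sub S \<Longrightarrow> P x \<Longrightarrow> P y \<Longrightarrow> P (x + y)"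
    and scaleC: "\<And>c x. x \<in> uea_sub S \<Longrightarrow> P x \<Longrightarrow> P (c *\<^sub>C x)"
    and word: "\<And>\<alpha> x. \<alpha> \<in> S \<Longrightarrow> x \<in> uea_sub S \<Longrightarrow> P x \<Longrightarrow> P (Gen \<alpha> * x)"
  shows "P x"
proof -
  have "\<forall>y\<in>uea_sub S. P y \<longrightarrow> P (x * y)"
    using x
  proof (induction rule: uea_sub.induct)
    case (scal c)
    then show ?case by (auto simp: uea_scaleC_mult_left intro: scaleC)
  next
    case (gen x)
    then show ?case by (auto intro: word)
  next
    case (add a b)
    then show ?case by (auto simp: semiring_class.distrib_right intro: assms uea_sub.mul)
  next
    case (mul a b)
    then show ?case by (auto simp: mult.assoc intro: uea_sub.mul)
  qed
  moreover have "1 \<in> uea_sub S"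
    using uea_sub.scal[of 1 S] by (simp add: scaleC_one)
  ultimately show ?thesis
    using one by force
qed

lemma uea_sub_one: "1 \<in> uea_sub S"
  using uea_sub.scal[of 1 S] by (simp add: scaleC_one)

lemma uea_sub_scaleC: "x \<in> uea_sub S \<Longrightarrow> c *\<^sub>C x \<in> uea_sub S"
  using uea_sub.mul[OF uea_sub.scal[of c S]] by (force simp: uea_scaleC_mult_left)

lemma uea_sub_diff: "x \<in> uea_sub S \<Longrightarrow> y \<in> uea_sub S \<Longrightarrow> x - y \<in> uea_sub S"
  using uea_sub.add[of x S "(-1) *\<^sub>C y"] uea_sub_scaleC[of y S "-1"]
  by (simp add: scaleC_minus_one)

lemma uea_sub_mono: "S \<subseteq> T \<Longrightarrow> uea_sub S \<subseteq> uea_sub T"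
proof
  fix x assume "S \<subseteq> T" "x \<in> uea_sub S"
  from this(2,1) show "x \<in> uea_sub T"
    by (induction rule: uea_sub.induct) (auto intro: uea_sub.intros)
qed

text \<open>
  The action of a term of the enveloping algebra of \<open>L\<close> on a pair \<open>(F, y)\<close> of a function \<open>F\<close> from
  \<open>L\<close> to the enveloping algebra and an element \<open>y\<close> of the latter.  Such a pair with \<open>F\<close> linear is a
  linear map on the one-dimensional extension \<open>L + \<complex>\<close> of the adjoint module given by the cocycle
  \<open>w\<close>, and \<open>y\<close> is its value on the generator of \<open>\<complex>\<close>.  Only the component \<open>F\<close> of the result is
  recorded; the other one is the product of the element with \<open>y\<close>.
\<close>

primrec ext_act :: "('l \<Rightarrow> 'l \<Rightarrow> complex) \<Rightarrow> 'l::complex_lie_algebra uea_term \<Rightarrow>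
    ('l \<Rightarrow> 'l uea) \<Rightarrow> 'l uea \<Rightarrow> 'l \<Rightarrow> 'l uea" where
  "ext_act w (TScal c) F y = (\<lambda>X. c *\<^sub>C F X)"
| "ext_act w (TGen a) F y = (\<lambda>X. Gen a * F X + F (lie X a) + w X a *\<^sub>C y)"
| "ext_act w (TAdd s t) F y = (\<lambda>X. ext_act w s F y X + ext_act w t F y X)"
| "ext_act w (TMul s t) F y = ext_act w s (ext_act w t F y) (abs_uea t * y)"

lemma ext_act_add:
  "ext_act w s (\<lambda>X. F X + G X) (y + y') X = ext_act w s F y X + ext_act w s G y' X"
proof (induction s arbitrary: F G y y' X)
  case (TMul s1 s2)
  from TMul(2) have "ext_act w s2 (\<lambda>X. F X + G X) (y + y') =
      (\<lambda>X. ext_act w s2 F y X + ext_act w s2 G y' X)" by blast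
  then show ?case by (simp add: semiring_class.distrib_left TMul(1))
qed (simp_all add: scaleC_add_right semiring_class.distrib_left algebra_simps)

lemma ext_act_scaleC:
  "ext_act w s (\<lambda>X. c *\<^sub>C F X) (c *\<^sub>C y) X = c *\<^sub>C ext_act w s F y X"
proof (induction s arbitrary: F y X)
  case (TMul s1 s2)
  from TMul(2) have "ext_act w s2 (\<lambda>X. c *\<^sub>C F X) (c *\<^sub>C y) = (\<lambda>X. c *\<^sub>C ext_act w s2 F y X)"
    by blast
  then show ?case by (simp add: uea_scaleC_mult_right TMul(1))
qed (simp_all add: scaleC_add_right scaleC_scaleC uea_scaleC_mult_right mult.commute)

text \<open>Complex linear maps.\<close>

definition clinear :: "('a::complex_vec \<Rightarrow> 'b::complex_vec) \<Rightarrow> bool" where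
  "clinear F \<longleftrightarrow> (\<forall>x y. F (x + y) = F x + F y) \<and> (\<forall>c x. F (c *\<^sub>C x) = c *\<^sub>C F x)"

context
  fixes w :: "'l::complex_lie_algebra \<Rightarrow> 'l \<Rightarrow> complex"
  assumes w_add_left: "\<And>X Y a. w (X + Y) a = w X a + w Y a"
    and w_scaleC_left: "\<And>c X a. w (c *\<^sub>C X) a = c * w X a"
    and w_add_right: "\<And>X a b. w X (a + b) = w X a + w X b"
    and w_scaleC_right: "\<And>c X a. w X (c *\<^sub>C a) = c * w X a"
    and w_cocycle: "\<And>X a b. w X (lie a b) = w (lie X a) b - w (lie X b) a"
begin

lemma clinear_ext_act: "clinear F \<Longrightarrow> clinear (ext_act w s F y)"
proof (induction s arbitrary: F y)
  case (TScal c)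
  then show ?case by (auto simp: clinear_def scaleC_add_right scaleC_scaleC mult.commute)
next
  case (TGen x)
  then show ?case
    by (auto simp: clinear_def scaleC_add_right scaleC_add_left scaleC_scaleC semiring_class.distrib_left
        lie_add_left lie_scaleC_left w_add_left w_scaleC_left uea_scaleC_mult_right)
next
  case (TAdd s t)
  from TAdd.IH[OF TAdd.prems, of y] show ?case
    by (auto simp: clinear_def scaleC_add_right)
qed auto

lemma ext_act_cong:
  "uea_eq s t \<Longrightarrow> clinear F \<Longrightarrow> ext_act w s F y = ext_act w t F y"
proof (induction arbitrary: F y rule: uea_eq.induct)
  case (mul_cong s s' t t')
  then have "abs_uea t = abs_uea t'" by (simp add: uea.abs_eq_iff)
  with mul_cong show ?case by (simp add: clinear_ext_act)
next
  case (distrib_left r s t)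
  have "ext_act w r (\<lambda>X. ext_act w s F y X + ext_act w t F y X)
      (abs_uea s * y + abs_uea t * y) X = 
      ext_act w r (ext_act w s F y) (abs_uea s * y) X +
      ext_act w r (ext_act w t F y) (abs_uea t * y) X" for X
    by (rule ext_act_add)
  then show ?case
    by (simp add: plus_uea.abs_eq[symmetric] semiring_class.distrib_right fun_eq_iff)
next
  case (scal_central a s)
  have "ext_act w s (\<lambda>X. a *\<^sub>C F X) (a *\<^sub>C y) X = a *\<^sub>C ext_act w s F y X" for X
    by (rule ext_act_scaleC)
  then show ?case
    by (simp add: abs_uea_TScal uea_scaleC_mult_left fun_eq_iff)
next
  case (gen_lie x y')
  then have "F (X + Y) = F X + F Y" for X Y by (simp add: clinear_def)
  from this[of "lie (lie X x) y' - lie (lie X y') x" "lie (lie X y') x" for X]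
  have "F (lie X (lie x y')) = F (lie (lie X x) y') - F (lie (lie X y') x)" for X
    by (simp add: lie_derivation)
  moreover have "abs_uea (TGen a) = Gen a" for a :: 'l
    by (simp add: Gen.abs_eq)
  ultimately show ?case
    by (simp add: fun_eq_iff Gen_lie w_cocycle algebra_simps scaleC_diff_left uea_scaleC_mult_right)
next
  case (mul_one s)
  then show ?case by (simp add: scaleC_one)
next
  case (mul_assoc r s t)
  then show ?case by (simp add: times_uea.abs_eq[symmetric] mult.assoc)
next
  case (gen_add x z)
  then show ?case
    by (simp add: fun_eq_iff Gen_add algebra_simps lie_add_right w_add_right scaleC_add_left clinear_def)
next
  case (gen_scaleC a x)
  then show ?case
    by (simp add: fun_eq_iff Gen_scaleC lie_scaleC_right w_scaleC_right scaleC_add_right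
        scaleC_scaleC uea_scaleC_mult_left clinear_def)
qed (simp_all add: scaleC_one fun_eq_iff algebra_simps scaleC_add_left scaleC_scaleC scaleC_minus_one)

text \<open>
  The orbit map of a pair \<open>(p, 1)\<close>.  A recursion along words defines it on the whole enveloping
  algebra of \<open>L\<close> without ambiguity, whence also on those of subalgebras, and no basis of
  Poincare-Birkhoff-Witt type is required.
\<close>

lemma uea_recursion:
  assumes p: "clinear p"
  obtains D :: "'l \<Rightarrow> 'l uea \<Rightarrow> 'l uea"
  where "\<And>X. D X 1 = p X" "\<And>X. clinear (D X)" "\<And>x. clinear (\<lambda>X. D X x)"
    "\<And>X a x. D X (Gen a * x) = Gen a * D X x + D (lie X a) x + w X a *\<^sub>C x"
proof -
  define D where "D X x = ext_act w (rep_uea x) p 1 X" for X x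
  have D_abs: "D X (abs_uea s) = ext_act w s p 1 X" for X s
  proof -
    have "uea_eq (rep_uea (abs_uea s)) s"
      using Quotient3_uea by (metis Quotient3_abs_rep uea.abs_eq_iff)
    then show ?thesis unfolding D_def by (simp add: ext_act_cong[OF _ p])
  qed
  have "D X 1 = p X" for X
    by (simp add: one_uea.abs_eq D_abs scaleC_one)
  moreover have "clinear (D X)" for X
    unfolding clinear_def
  proof safe
    fix x y :: "'l uea" and c
    obtain s t where "x = abs_uea s" "y = abs_uea t"
      using Quotient3_uea by (metis Quotient3_abs_rep)
    then show "D X (x + y) = D X x + D X y" "D X (c *\<^sub>C x) = c *\<^sub>C D X x"
      by (simp_all add: plus_uea.abs_eq scaleC_uea.abs_eq D_abs)
  qed
  moreover have "clinear (\<lambda>X. D X x)" for x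
    using clinear_ext_act[OF p, of "rep_uea x" 1] unfolding D_def .
  moreover have "D X (Gen a * x) = Gen a * D X x + D (lie X a) x + w X a *\<^sub>C x" for X a x
  proof -
    obtain s where "x = abs_uea s"
      using Quotient3_uea by (metis Quotient3_abs_rep)
    then show ?thesis
      by (simp add: times_uea.abs_eq Gen.abs_eq D_abs)
  qed
  ultimately show thesis
    by (rule that)
qed

end

section \<open>Vector-valued functions\<close>

lemma form_add_right: "form (x::'g::metric_lie_algebra) (y + z) = form x y + form x z"
  by (metis form_add_left form_sym)

lemma form_scaleC_right: "form (x::'g::metric_lie_algebra) (c *\<^sub>C y) = c * form x y"
  by (metis form_scaleC_left form_sym)

lemma form_zero_right [simp]: "form (x::'g::metric_lie_algebra) 0 = 0"
  using form_add_right[of x 0 0] by simp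

lemma form_minus_right: "form (x::'g::metric_lie_algebra) (- y) = - form x y"
  using form_scaleC_right[of x "-1" y] by (simp add: scaleC_minus_one)

lemma form_diff_right: "form (x::'g::metric_lie_algebra) (y - z) = form x y - form x z"
  using form_add_right[of x y "- z"] by (simp add: form_minus_right)

lemma form_eqI:
  assumes "\<And>w. form w x = form w (y::'g::metric_lie_algebra)"
  shows "x = y"
proof -
  have "form (x - y) w = 0" for w
    using assms[of w] by (metis form_diff_right form_sym right_minus_eq)
  then show ?thesis
    using form_nondegenerate[of "x - y"] by simp
qed

lemmas bilinear_simps =
  lie_add_left lie_add_right lie_scaleC_left lie_scaleC_right
  form_add_left form_add_right form_scaleC_left form_scaleC_right
  scaleC_add_left scaleC_add_right scaleC_scaleC

text \<open>
  Algebras of scalar functions that need not contain the constants (the functions vanishing at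
  \<open>P\<close> do not).
\<close>

definition fun_algebra :: "(complex \<Rightarrow> complex) set \<Rightarrow> bool" where
  "fun_algebra C \<longleftrightarrow>
     (\<forall>c\<in>C. \<forall>d\<in>C. (\<lambda>u. c u + d u) \<in> C) \<and>
     (\<forall>c\<in>C. \<forall>d\<in>C. (\<lambda>u. c u * d u) \<in> C) \<and>
     (\<forall>c\<in>C. \<forall>a. (\<lambda>u. a * c u) \<in> C)"

lemma fun_algebra_analytic: "fun_algebra {c. c analytic_on A}"
  by (auto simp: fun_algebra_def intro!: analytic_intros)

lemma fun_algebra_meromorphic: "fun_algebra {c. c meromorphic_on A}"
  by (auto simp: fun_algebra_def intro!: meromorphic_intros)

lemma vec_fun_mono: "C \<subseteq> C' \<Longrightarrow> vec_fun C \<subseteq> vec_fun C'"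
proof
  fix f :: "complex \<Rightarrow> 'a"
  assume "C \<subseteq> C'" "f \<in> vec_fun C"
  from this(2,1) show "f \<in> vec_fun C'"
    by (induction rule: vec_fun.induct) (auto intro: vec_fun.intros)
qed

lemma vec_fun_meromorphic:
  assumes "f \<in> vec_fun mero_vanishing"
  shows "f \<in> vec_fun {c. c meromorphic_on {z}}"
proof -
  have "mero_vanishing \<subseteq> {c. c meromorphic_on {z}}"
    by (auto simp: mero_vanishing_def intro: meromorphic_on_subset)
  then show ?thesis
    using assms vec_fun_mono by blast
qed

lemma vec_fun_scaleC:
  assumes "fun_algebra C" "f \<in> vec_fun C"
  shows "(\<lambda>u. a *\<^sub>C f u) \<in> vec_fun C"
  using assms(2)
proof (induction rule: vec_fun.induct)
  case (pure c v)
  then have "(\<lambda>u. (a * c u) *\<^sub>C v) \<in> vec_fun C"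
    using assms(1) by (intro vec_fun.pure) (simp add: fun_algebra_def)
  then show ?case by (simp add: scaleC_scaleC)
qed (auto simp: scaleC_add_right intro: vec_fun.add)

lemma vec_fun_lie_const:
  assumes "f \<in> vec_fun C"
  shows "(\<lambda>u. lie v (f u)) \<in> vec_fun C"
  using assms
  by (induction rule: vec_fun.induct) (auto simp: lie_add_right lie_scaleC_right intro: vec_fun.intros)

lemma vec_fun_lie:
  assumes C: "fun_algebra C" and f: "f \<in> vec_fun C" and g: "g \<in> vec_fun C"
  shows "(\<lambda>u. lie (f u) (g u)) \<in> vec_fun C"
  using f g
proof (induction rule: vec_fun.induct)
  case (pure c v)
  note c = pure.hyps
  from pure.prems show ?case
  proof (induction rule: vec_fun.induct)
    case (pure d w)
    then have "(\<lambda>u. (c u * d u) *\<^sub>C lie v w) \<in> vec_fun C"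
      using C c by (intro vec_fun.pure) (simp add: fun_algebra_def)
    then show ?case by (simp add: bilinear_simps mult.commute)
  qed (auto simp: lie_add_right intro: vec_fun.add)
qed (auto simp: lie_add_left intro: vec_fun.add)

lemma vec_fun_form:
  assumes C: "fun_algebra C" and f: "f \<in> vec_fun C" and g: "g \<in> vec_fun C"
  shows "(\<lambda>u. form (f u) (g u)) \<in> C"
  using f g
proof (induction rule: vec_fun.induct)
  case (pure c v)
  note c = pure.hyps
  from pure.prems show ?case
  proof (induction rule: vec_fun.induct)
    case (pure d w)
    then have "(\<lambda>u. form v w * (c u * d u)) \<in> C"
      using C c by (simp add: fun_algebra_def)
    then show ?case by (simp add: bilinear_simps algebra_simps)
  next
    case (add g h)
    then show ?case using C by (auto simp: form_add_right fun_algebra_def)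
  qed
next
  case (add g h)
  then show ?case using C by (auto simp: form_add_left fun_algebra_def)
qed

lemma vec_fun_form_const:
  assumes C: "fun_algebra C" and f: "f \<in> vec_fun C"
  shows "(\<lambda>u. form w (f u)) \<in> C"
  using f
proof (induction rule: vec_fun.induct)
  case (pure c v)
  then have "(\<lambda>u. form w v * c u) \<in> C"
    using C by (simp add: fun_algebra_def)
  then show ?case by (simp add: bilinear_simps algebra_simps)
next
  case (add g h)
  then show ?case using C by (auto simp: form_add_right fun_algebra_def)
qed

section \<open>Elements of the algebra of meromorphic maps\<close>

text \<open>
  \<open>f\<close> is one of the functions, equal up to finitely many values, that make up the class \<open>\<alpha>\<close>.
\<close>

definition represents :: "'g::complex_vec gminus \<Rightarrow> (complex \<Rightarrow> 'g) \<Rightarrow> bool" where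
  "represents \<alpha> f \<longleftrightarrow> f \<in> vec_fun mero_vanishing \<and> \<alpha> = abs_gminus f"

lemma regular_rep_iff:
  "regular_rep z \<alpha> f \<longleftrightarrow> represents \<alpha> f \<and> f \<in> vec_fun {c. c analytic_on {z}}"
  by (auto simp: regular_rep_def represents_def)

lemma mero_rel_refl: "f \<in> vec_fun mero_vanishing \<Longrightarrow> mero_rel f f"
  by (simp add: mero_rel_def)

lemma ex_represents: "\<exists>f. represents \<alpha> f"
proof (rule gminus.abs_induct[of _ \<alpha>])
  show "\<exists>f. represents (abs_gminus y) f" if "mero_rel y y" for y :: "complex \<Rightarrow> 'a"
    using that by (auto simp: represents_def mero_rel_def)
qed

lemma represents_eq_iff:
  assumes "represents \<alpha> f" "represents \<beta> g"
  shows "\<alpha> = \<beta> \<longleftrightarrow> finite {u. f u \<noteq> g u}"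
  using assms Quotient3_rel[OF Quotient3_gminus, of f g]
  by (auto simp: represents_def mero_rel_def)

lemma represents_add:
  "represents \<alpha> f \<Longrightarrow> represents \<beta> g \<Longrightarrow> represents (\<alpha> + \<beta>) (\<lambda>u. f u + g u)"
  by (auto simp: represents_def plus_gminus.abs_eq mero_rel_refl vec_fun.add)

lemma represents_scaleC:
  "represents \<alpha> f \<Longrightarrow> represents (a *\<^sub>C \<alpha>) (\<lambda>u. a *\<^sub>C f u)"
  by (auto simp: represents_def scaleC_gminus.abs_eq mero_rel_refl scaleC_vec_fun)

lemma represents_lie:
  "represents \<alpha> f \<Longrightarrow> represents \<beta> g \<Longrightarrow> represents (lie \<alpha> \<beta>) (\<lambda>u. lie (f u) (g u))"
  by (auto simp: represents_def lie_gminus.abs_eq mero_rel_refl lie_vec_fun)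

lemma represents_pure: "c \<in> mero_vanishing \<Longrightarrow> represents (pure_map c v) (\<lambda>u. c u *\<^sub>C v)"
  by (simp add: represents_def pure_map_def vec_fun.pure)

lemma represents_change:
  assumes "represents \<alpha> f" "g \<in> vec_fun mero_vanishing" "finite {u. f u \<noteq> g u}"
  shows "represents \<alpha> g"
  using assms represents_eq_iff[of \<alpha> f "abs_gminus g" g] by (auto simp: represents_def)

lemma finite_imp_eventually_at:
  assumes "finite {u. \<not> P u}"
  shows "\<forall>\<^sub>F u in at (z::complex). P u"
proof -
  have "open (- ({u. \<not> P u} - {z}))"
    using assms by (intro open_Compl finite_imp_closed) auto
  then show ?thesis
    unfolding eventually_at_topological
    by (intro exI[of _ "- ({u. \<not> P u} - {z})"]) auto
qed

lemma represents_eventually_eq: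
  "represents \<alpha> f \<Longrightarrow> represents \<alpha> g \<Longrightarrow> \<forall>\<^sub>F u in at z. f u = g u"
  using represents_eq_iff[of \<alpha> f \<alpha> g] by (intro finite_imp_eventually_at) auto

text \<open>
  Linear functionals of the form \<open>form w\<close> separate points, which reduces statements about values
  to scalar functions.
\<close>

lemma regular_rep_unique_value:
  assumes "regular_rep z \<alpha> f" "regular_rep z \<alpha> (g::complex \<Rightarrow> 'g::metric_lie_algebra)"
  shows "f z = g z"
proof (rule form_eqI)
  fix w
  have an: "(\<lambda>u. form w (f u)) analytic_on {z}" "(\<lambda>u. form w (g u)) analytic_on {z}"
    using assms vec_fun_form_const[OF fun_algebra_analytic] by (auto simp: regular_rep_iff)
  have "\<forall>\<^sub>F u in at z. form w (f u) = form w (g u)"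
    using represents_eventually_eq[of \<alpha> f g z] assms
    by (auto simp: regular_rep_iff elim: eventually_mono)
  moreover have f: "(\<lambda>u. form w (f u)) \<midarrow>z\<rightarrow> form w (f z)" and "(\<lambda>u. form w (g u)) \<midarrow>z\<rightarrow> form w (g z)"
    using an by (auto intro!: isContD analytic_at_imp_isCont)
  ultimately have "(\<lambda>u. form w (f u)) \<midarrow>z\<rightarrow> form w (g z)"
    by (simp add: tendsto_cong)
  with f show "form w (f z) = form w (g z)"
    by (rule LIM_unique)
qed

lemma value_at_eq:
  assumes "regular_rep z \<alpha> (f::complex \<Rightarrow> 'g::metric_lie_algebra)"
  shows "value_at z \<alpha> = f z"
  unfolding value_at_def by (rule regular_rep_unique_value[OF someI[of "regular_rep z \<alpha>"]]) fact+

lemma form_deriv_at_eq: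
  assumes "regular_rep z \<alpha> f"
  shows "form_deriv_at z v \<alpha> = deriv (\<lambda>u. form v (f u)) z"
proof -
  define g where "g = (SOME f. regular_rep z \<alpha> f)"
  have g: "regular_rep z \<alpha> g"
    unfolding g_def using someI[of "regular_rep z \<alpha>", OF assms] .
  have "\<forall>\<^sub>F u in at z. g u = f u"
    using represents_eventually_eq[of \<alpha> g f z] g assms by (auto simp: regular_rep_iff)
  then have "\<forall>\<^sub>F u in nhds z. g u = f u"
    using regular_rep_unique_value[OF g assms] by (auto simp: eventually_nhds_conv_at)
  then have "\<forall>\<^sub>F u in nhds z. form v (g u) = form v (f u)"
    by (auto elim: eventually_mono)
  then show ?thesis
    unfolding form_deriv_at_def g_def[symmetric] by (intro deriv_cong_ev) auto
qed

section \<open>Residues\<close>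

lemma residue_add_meromorphic:
  assumes "f meromorphic_on {z}" "g meromorphic_on {z}"
  shows "residue (\<lambda>u. f u + g u) z = residue f z + residue g z"
proof -
  from assms obtain F G where "(\<lambda>x. f (z + x)) has_laurent_expansion F"
    "(\<lambda>x. g (z + x)) has_laurent_expansion G"
    by (auto simp: meromorphic_on_def)
  then show ?thesis
    using has_laurent_expansion_add[of "\<lambda>x. f (z + x)" F "\<lambda>x. g (z + x)" G]
    by (simp add: has_laurent_expansion_residue[of f z F] has_laurent_expansion_residue[of g z G]
        has_laurent_expansion_residue[of "\<lambda>u. f u + g u" z "F + G"])
qed

lemma residue_cmult_meromorphic:
  assumes "f meromorphic_on {z}"
  shows "residue (\<lambda>u. a * f u) z = a * residue f z"
proof -
  from assms obtain F where "(\<lambda>x. f (z + x)) has_laurent_expansion F"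
    by (auto simp: meromorphic_on_def)
  then show ?thesis
    using has_laurent_expansion_cmult_left[of "\<lambda>x. f (z + x)" F a]
    by (simp add: has_laurent_expansion_residue[of f z F]
        has_laurent_expansion_residue[of "\<lambda>u. a * f u" z "fls_const a * F"])
qed

lemma residue_analytic: "f analytic_on {z} \<Longrightarrow> residue f z = 0"
  unfolding analytic_at by (metis residue_holo)

lemma residue_analytic_over_linear:
  "f analytic_on {z} \<Longrightarrow> residue (\<lambda>u. f u / (u - z)) z = f z"
  unfolding analytic_at by (metis residue_simple)

text \<open>
  The residue of \<open>\<alpha> du\<close> at \<open>z\<close>, an element of the Lie algebra, determined by its products with all
  vectors because the form is nondegenerate.
\<close>

definition vec_residue :: "complex \<Rightarrow> 'g::metric_lie_algebra gminus \<Rightarrow> 'g" where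
  "vec_residue z \<alpha> =
     (THE y. \<forall>w. form w y = residue (\<lambda>u. form w ((SOME f. represents \<alpha> f) u)) z)"

lemma ex_vec_residue:
  assumes "f \<in> vec_fun {c. c meromorphic_on {z}}"
  shows "\<exists>y. \<forall>w. form w y = residue (\<lambda>u. form w (f u)) z"
  using assms
proof (induction rule: vec_fun.induct)
  case (pure c v)
  then have "\<forall>w. form w (residue c z *\<^sub>C v) = residue (\<lambda>u. form w (c u *\<^sub>C v)) z"
    by (simp add: form_scaleC_right mult.commute[of _ "form _ v"] residue_cmult_meromorphic)
  then show ?case ..
next
  case (add f g)
  then obtain x y where "\<And>w. form w x = residue (\<lambda>u. form w (f u)) z"
    "\<And>w. form w y = residue (\<lambda>u. form w (g u)) z"
    by blast
  then have "\<forall>w. form w (x + y) = residue (\<lambda>u. form w (f u + g u)) z"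
    using vec_fun_form_const[OF fun_algebra_meromorphic add(1)]
      vec_fun_form_const[OF fun_algebra_meromorphic add(2)]
    by (simp add: form_add_right residue_add_meromorphic)
  then show ?case ..
qed

lemma form_vec_residue:
  assumes "represents \<alpha> f"
  shows "form w (vec_residue z \<alpha>) = residue (\<lambda>u. form w (f u)) z"
proof -
  define g where "g = (SOME f. represents \<alpha> f)"
  have g: "represents \<alpha> g"
    unfolding g_def using someI[of "represents \<alpha>", OF assms] .
  then obtain y where y: "\<And>w. form w y = residue (\<lambda>u. form w (g u)) z"
    using ex_vec_residue[of g z] vec_fun_meromorphic[of g z] by (auto simp: represents_def)
  have "vec_residue z \<alpha> = y"
    unfolding vec_residue_def g_def[symmetric]
    by (rule the_equality) (auto simp: y intro: form_eqI)
  moreover have "residue (\<lambda>u. form w (g u)) z = residue (\<lambda>u. form w (f u)) z"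
    using represents_eventually_eq[OF g assms, of z]
    by (intro residue_cong) (auto elim: eventually_mono)
  ultimately show ?thesis by (simp add: y)
qed

lemma form_mero_meromorphic:
  assumes "represents \<alpha> f"
  shows "(\<lambda>u. form w (f u)) meromorphic_on {z}"
  using vec_fun_form_const[OF fun_algebra_meromorphic, of f "{z}" w]
    vec_fun_meromorphic[of f z] assms by (auto simp: represents_def)

lemma clinear_vec_residue: "clinear (vec_residue z)"
  unfolding clinear_def
proof safe
  fix \<alpha> \<beta> :: "'a gminus" and c
  obtain f g where f: "represents \<alpha> f" and g: "represents \<beta> g"
    using ex_represents by blast
  show "vec_residue z (\<alpha> + \<beta>) = vec_residue z \<alpha> + vec_residue z \<beta>"
    using form_mero_meromorphic[OF f] form_mero_meromorphic[OF g]
    by (intro form_eqI) (simp add: form_vec_residue[OF represents_add[OF f g]] form_add_right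
        form_vec_residue[OF f] form_vec_residue[OF g] residue_add_meromorphic)
  show "vec_residue z (c *\<^sub>C \<alpha>) = c *\<^sub>C vec_residue z \<alpha>"
    using form_mero_meromorphic[OF f]
    by (intro form_eqI) (simp add: form_vec_residue[OF represents_scaleC[OF f]] form_scaleC_right
        form_vec_residue[OF f] residue_cmult_meromorphic)
qed

lemma vec_residue_regular: "regular_at z \<alpha> \<Longrightarrow> vec_residue z \<alpha> = 0"
proof (rule form_eqI)
  fix w
  assume "regular_at z \<alpha>"
  then obtain f where f: "represents \<alpha> f" "f \<in> vec_fun {c. c analytic_on {z}}"
    by (auto simp: regular_at_def regular_rep_iff)
  then show "form w (vec_residue z \<alpha>) = form w 0"
    using vec_fun_form_const[OF fun_algebra_analytic f(2), of w]
    by (simp add: form_vec_residue residue_analytic)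
qed

lemma linear_pole_mero_vanishing: "(\<lambda>u. 1 / (u - z)) \<in> mero_vanishing"
proof -
  have "filterlim (\<lambda>u. u + (- z)) at_infinity at_infinity"
    by (rule tendsto_add_filterlim_at_infinity'[OF filterlim_ident tendsto_const])
  then have "((\<lambda>u. inverse (u + (- z))) \<longlongrightarrow> 0) at_infinity"
    by (rule filterlim_compose[OF tendsto_inverse_0])
  then have "((\<lambda>u. 1 / (u - z)) \<longlongrightarrow> 0) at_infinity"
    by (simp add: inverse_eq_divide)
  then show ?thesis
    by (auto simp: mero_vanishing_def intro!: meromorphic_intros)
qed

lemma represents_eps: "represents (eps z v) (\<lambda>u. (1 / (u - z)) *\<^sub>C v)"
  unfolding eps_def by (rule represents_pure[OF linear_pole_mero_vanishing])

lemma vec_residue_eps: "vec_residue z (eps z v) = v"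
proof (rule form_eqI)
  fix w
  have "residue (\<lambda>u. form w v / (u - z)) z = form w v"
    by (rule residue_analytic_over_linear) auto
  then show "form w (vec_residue z (eps z v)) = form w v"
    by (simp add: form_vec_residue[OF represents_eps] form_scaleC_right)
qed

section \<open>The residue cocycle\<close>

text \<open>
  \<open>vec_deriv z f f'\<close>: the function \<open>f'\<close> is obtained by differentiating the coefficients of an
  expression of \<open>f\<close> as a sum of scalar functions meromorphic at \<open>z\<close> times vectors.  It may depend on
  the expression at the poles, but residues do not notice this.
\<close>

inductive vec_deriv :: "complex \<Rightarrow> (complex \<Rightarrow> 'g::complex_vec) \<Rightarrow> (complex \<Rightarrow> 'g) \<Rightarrow> bool" for z where
  pure: "c meromorphic_on {z} \<Longrightarrow> vec_deriv z (\<lambda>u. c u *\<^sub>C v) (\<lambda>u. deriv c u *\<^sub>C v)"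
| add: "vec_deriv z f f' \<Longrightarrow> vec_deriv z g g' \<Longrightarrow> vec_deriv z (\<lambda>u. f u + g u) (\<lambda>u. f' u + g' u)"

lemma ex_vec_deriv:
  assumes "f \<in> vec_fun {c. c meromorphic_on {z}}"
  shows "\<exists>f'. vec_deriv z f f'"
  using assms by (induction rule: vec_fun.induct) (auto intro: vec_deriv.intros)

lemma vec_deriv_meromorphic:
  "vec_deriv z f f' \<Longrightarrow> f' \<in> vec_fun {c. c meromorphic_on {z}}"
  by (induction rule: vec_deriv.induct) (auto intro!: vec_fun.intros meromorphic_on_deriv)

lemma meromorphic_eventually_deriv:
  assumes "c meromorphic_on {z}"
  shows "\<forall>\<^sub>F u in at z. (c has_field_derivative deriv c u) (at u)"
proof -
  have "isolated_singularity_at c z"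
    using assms by (rule meromorphic_on_isolated_singularity)
  then have "\<forall>\<^sub>F u in at z. c analytic_on {u}"
    by (rule isolated_singularity_at_altdef[THEN iffD1])
  then show ?thesis
    by eventually_elim (simp add: DERIV_deriv_iff_field_differentiable analytic_on_imp_differentiable_at)
qed

lemma vec_deriv_form:
  assumes "vec_deriv z f f'"
  shows "\<forall>\<^sub>F u in at z. \<forall>w. ((\<lambda>s. form w (f s)) has_field_derivative form w (f' u)) (at u)"
  using assms
proof (induction rule: vec_deriv.induct)
  case (pure c v)
  from meromorphic_eventually_deriv[OF pure] show ?case
    by eventually_elim (auto simp: form_scaleC_right intro!: derivative_eq_intros)
next
  case (add f f' g g')
  from add.IH show ?case
    by eventually_elim (auto simp: form_add_right intro!: derivative_intros)
qed

lemma vec_deriv_lie_form: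
  assumes "vec_deriv z f f'" "vec_deriv z g g'"
  shows "\<forall>\<^sub>F u in at z. \<forall>w. ((\<lambda>s. form w (lie (f s) (g s))) has_field_derivative
      form w (lie (f' u) (g u) + lie (f u) (g' u))) (at u)"
  using assms
proof (induction rule: vec_deriv.induct)
  case (pure c v)
  note c = meromorphic_eventually_deriv[OF pure.hyps]
  from pure.prems show ?case
  proof (induction rule: vec_deriv.induct)
    case (pure d v')
    from c meromorphic_eventually_deriv[OF pure] show ?case
      by eventually_elim (auto simp: bilinear_simps algebra_simps intro!: derivative_eq_intros)
  next
    case (add g g' h h')
    from add.IH show ?case
      by eventually_elim (auto simp: form_add_right lie_add_right algebra_simps
          intro!: derivative_eq_intros)
  qed
next
  case (add f f' h h')
  from add.IH[OF add.prems] show ?case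
    by eventually_elim (auto simp: form_add_right lie_add_left algebra_simps
          intro!: derivative_eq_intros)
qed

lemma ex_vec_deriv_analytic:
  assumes "f \<in> vec_fun {c. c analytic_on {z}}"
  shows "\<exists>f'. vec_deriv z f f' \<and> f' \<in> vec_fun {c. c analytic_on {z}} \<and>
    (\<forall>w. ((\<lambda>s. form w (f s)) has_field_derivative form w (f' z)) (at z))"
  using assms
proof (induction rule: vec_fun.induct)
  case (pure c v)
  then have "(c has_field_derivative deriv c z) (at z)"
    by (simp add: DERIV_deriv_iff_field_differentiable analytic_on_imp_differentiable_at)
  then have "\<forall>w. ((\<lambda>s. form w (c s *\<^sub>C v)) has_field_derivative form w (deriv c z *\<^sub>C v)) (at z)"
    by (auto simp: form_scaleC_right intro!: derivative_eq_intros)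
  with pure show ?case
    by (intro exI[of _ "\<lambda>u. deriv c u *\<^sub>C v"])
      (auto intro!: vec_deriv.pure vec_fun.pure analytic_on_imp_meromorphic_on analytic_deriv)
next
  case (add f g)
  then obtain f' g' where
    "vec_deriv z f f'" "f' \<in> vec_fun {c. c analytic_on {z}}"
    "\<forall>w. ((\<lambda>s. form w (f s)) has_field_derivative form w (f' z)) (at z)"
    "vec_deriv z g g'" "g' \<in> vec_fun {c. c analytic_on {z}}"
    "\<forall>w. ((\<lambda>s. form w (g s)) has_field_derivative form w (g' z)) (at z)"
    by blast
  then show ?case
    by (intro exI[of _ "\<lambda>u. f' u + g' u"])
      (auto simp: form_add_right intro!: vec_deriv.add vec_fun.add derivative_intros)
qed

text \<open>
  The residue at \<open>z\<close> of the differential \<open>form \<alpha> (d \<beta>)\<close>.  To avoid derivatives of vector-valued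
  functions, \<open>\<beta>\<close> is differentiated after pairing with the value of \<open>\<alpha>\<close> at the same point.
\<close>

definition res_pairing ::
    "complex \<Rightarrow> 'g::metric_lie_algebra gminus \<Rightarrow> 'g gminus \<Rightarrow> complex" where
  "res_pairing z \<alpha> \<beta> = residue (\<lambda>u. deriv (\<lambda>s. form ((SOME f. represents \<alpha> f) u)
     ((SOME g. represents \<beta> g) s)) u) z"

lemma res_pairing_eqI:
  fixes g' :: "complex \<Rightarrow> 'g::metric_lie_algebra"
  assumes f: "represents \<alpha> f" and g: "represents \<beta> g"
    and g': "\<forall>\<^sub>F u in at z. \<forall>w. ((\<lambda>s. form w (g s)) has_field_derivative form w (g' u)) (at u)"
  shows "res_pairing z \<alpha> \<beta> = residue (\<lambda>u. form (f u) (g' u)) z"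
proof -
  define F G where "F = (SOME f. represents \<alpha> f)" and "G = (SOME g. represents \<beta> g)"
  have F: "represents \<alpha> F"
    unfolding F_def using someI[of "represents \<alpha>", OF f] .
  have G: "represents \<beta> G"
    unfolding G_def using someI[of "represents \<beta>", OF g] .
  define B where "B = {s. G s \<noteq> g s}"
  have B: "finite B"
    unfolding B_def using represents_eq_iff[OF G g] by simp
  then have "\<forall>\<^sub>F u in at z. u \<notin> B"
    by (intro finite_imp_eventually_at) auto
  with g' represents_eventually_eq[OF F f, of z]
  have "\<forall>\<^sub>F u in at z. deriv (\<lambda>s. form (F u) (G s)) u = form (f u) (g' u)"
  proof eventually_elim
    case (elim u)
    have "\<forall>\<^sub>F s in nhds u. s \<in> - B"
      using elim(3) B by (intro eventually_nhds_in_open open_Compl finite_imp_closed) auto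
    then have "\<forall>\<^sub>F s in nhds u. form (F u) (G s) = form (f u) (g s)"
      by eventually_elim (simp add: B_def elim(2))
    then have "deriv (\<lambda>s. form (F u) (G s)) u = deriv (\<lambda>s. form (f u) (g s)) u"
      by (intro deriv_cong_ev) auto
    also have "\<dots> = form (f u) (g' u)"
      using elim(1) by (intro DERIV_imp_deriv) blast
    finally show ?case .
  qed
  then show ?thesis
    unfolding res_pairing_def F_def[symmetric] G_def[symmetric] by (intro residue_cong) auto
qed

lemma ex_represents_deriv:
  "\<exists>f f'. represents \<alpha> f \<and> vec_deriv z f f'"
  by (metis ex_represents ex_vec_deriv represents_def vec_fun_meromorphic)

lemma form_vec_deriv_meromorphic:
  assumes "represents \<alpha> f" "vec_deriv z g g'"
  shows "(\<lambda>u. form (f u) (g' u)) meromorphic_on {z}"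
  using vec_fun_form[OF fun_algebra_meromorphic, of f "{z}" g'] vec_deriv_meromorphic[of z g g']
    vec_fun_meromorphic[of f z] assms by (simp add: represents_def)

lemma res_pairing_add_left:
  "res_pairing z (\<alpha> + \<beta>) \<gamma> = res_pairing z \<alpha> \<gamma> + res_pairing z \<beta> \<gamma>"
proof -
  obtain f g h h' where f: "represents \<alpha> f" and g: "represents \<beta> g"
    and h: "represents \<gamma> h" "vec_deriv z h h'"
    using ex_represents ex_represents_deriv by metis
  note * = form_vec_deriv_meromorphic[OF f h(2)] form_vec_deriv_meromorphic[OF g h(2)]
    vec_deriv_form[OF h(2)]
  show ?thesis
    using * by (simp add: res_pairing_eqI[OF represents_add[OF f g] h(1) *(3)]
        res_pairing_eqI[OF f h(1) *(3)] res_pairing_eqI[OF g h(1) *(3)]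
        form_add_left residue_add_meromorphic)
qed

lemma res_pairing_scaleC_left: "res_pairing z (c *\<^sub>C \<alpha>) \<gamma> = c * res_pairing z \<alpha> \<gamma>"
proof -
  obtain f h h' where f: "represents \<alpha> f" and h: "represents \<gamma> h" "vec_deriv z h h'"
    using ex_represents ex_represents_deriv by metis
  note * = form_vec_deriv_meromorphic[OF f h(2)] vec_deriv_form[OF h(2)]
  show ?thesis
    using * by (simp add: res_pairing_eqI[OF represents_scaleC[OF f] h(1) *(2)]
        res_pairing_eqI[OF f h(1) *(2)] form_scaleC_left residue_cmult_meromorphic)
qed

lemma res_pairing_add_right:
  "res_pairing z \<alpha> (\<beta> + \<gamma>) = res_pairing z \<alpha> \<beta> + res_pairing z \<alpha> \<gamma>"
proof -
  obtain f g g' h h' where f: "represents \<alpha> f" and g: "represents \<beta> g" "vec_deriv z g g'"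
    and h: "represents \<gamma> h" "vec_deriv z h h'"
    using ex_represents ex_represents_deriv by metis
  note * = form_vec_deriv_meromorphic[OF f g(2)] form_vec_deriv_meromorphic[OF f h(2)]
    vec_deriv_form[OF g(2)] vec_deriv_form[OF h(2)] vec_deriv_form[OF vec_deriv.add[OF g(2) h(2)]]
  show ?thesis
    using * by (simp add: res_pairing_eqI[OF f represents_add[OF g(1) h(1)] *(5)]
        res_pairing_eqI[OF f h(1) *(4)] res_pairing_eqI[OF f g(1) *(3)]
        form_add_right residue_add_meromorphic)
qed

lemma res_pairing_scaleC_right: "res_pairing z \<alpha> (c *\<^sub>C \<gamma>) = c * res_pairing z \<alpha> \<gamma>"
proof -
  obtain f h h' where f: "represents \<alpha> f" and h: "represents \<gamma> h" "vec_deriv z h h'"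
    using ex_represents ex_represents_deriv by metis
  note * = form_vec_deriv_meromorphic[OF f h(2)] vec_deriv_form[OF h(2)]
  have **: "\<forall>\<^sub>F u in at z. \<forall>w. ((\<lambda>s. form w (c *\<^sub>C h s)) has_field_derivative form w (c *\<^sub>C h' u)) (at u)"
    using *(2) by eventually_elim (auto simp: form_scaleC_right intro!: derivative_eq_intros)
  show ?thesis
    using * by (simp add: res_pairing_eqI[OF f represents_scaleC[OF h(1)] **]
        res_pairing_eqI[OF f h(1) *(2)] form_scaleC_right residue_cmult_meromorphic)
qed

text \<open>
  The pairing is the cocycle of the affine Lie algebra at \<open>z\<close>.  In this form the identity holds
  before taking residues, by the product rule and the invariance of the form.
\<close>

lemma res_pairing_cocycle:
  "res_pairing z \<alpha> (lie \<beta> \<gamma>) = res_pairing z (lie \<alpha> \<beta>) \<gamma> - res_pairing z (lie \<alpha> \<gamma>) \<beta>"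
proof -
  obtain f g g' h h' where f: "represents \<alpha> f" and g: "represents \<beta> g" "vec_deriv z g g'"
    and h: "represents \<gamma> h" "vec_deriv z h h'"
    using ex_represents ex_represents_deriv by metis
  have mero: "(\<lambda>u. form (lie (f u) (g u)) (h' u)) meromorphic_on {z}"
    "(\<lambda>u. (-1) * form (lie (f u) (h u)) (g' u)) meromorphic_on {z}"
    "(\<lambda>u. form (lie (f u) (h u)) (g' u)) meromorphic_on {z}"
    using form_vec_deriv_meromorphic[OF represents_lie[OF f g(1)] h(2)]
      form_vec_deriv_meromorphic[OF represents_lie[OF f h(1)] g(2)]
    by (auto intro!: meromorphic_intros)
  have "form (f u) (lie (g' u) (h u) + lie (g u) (h' u)) =
      form (lie (f u) (g u)) (h' u) + (-1) * form (lie (f u) (h u)) (g' u)" for u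
    using lie_anticomm[of "g' u" "h u"]
    by (simp add: form_invariant form_diff_right)
  then have "res_pairing z \<alpha> (lie \<beta> \<gamma>) =
      residue (\<lambda>u. form (lie (f u) (g u)) (h' u) + (-1) * form (lie (f u) (h u)) (g' u)) z"
    using res_pairing_eqI[OF f represents_lie[OF g(1) h(1)] vec_deriv_lie_form[OF g(2) h(2)]]
    by simp
  also have "\<dots> = residue (\<lambda>u. form (lie (f u) (g u)) (h' u)) z
      + (-1) * residue (\<lambda>u. form (lie (f u) (h u)) (g' u)) z"
    by (simp only: residue_add_meromorphic[OF mero(1,2)] residue_cmult_meromorphic[OF mero(3)])
  also have "\<dots> = res_pairing z (lie \<alpha> \<beta>) \<gamma> - res_pairing z (lie \<alpha> \<gamma>) \<beta>"
    using res_pairing_eqI[OF represents_lie[OF f g(1)] h(1) vec_deriv_form[OF h(2)]]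
      res_pairing_eqI[OF represents_lie[OF f h(1)] g(1) vec_deriv_form[OF g(2)]]
    by simp
  finally show ?thesis .
qed

lemma res_pairing_regular:
  assumes "regular_at z \<alpha>" "regular_at z \<beta>"
  shows "res_pairing z \<alpha> \<beta> = 0"
proof -
  from assms obtain f g where f: "represents \<alpha> f" "f \<in> vec_fun {c. c analytic_on {z}}"
    and g: "represents \<beta> g" "g \<in> vec_fun {c. c analytic_on {z}}"
    by (auto simp: regular_at_def regular_rep_iff)
  obtain g' where g': "vec_deriv z g g'" "g' \<in> vec_fun {c. c analytic_on {z}}"
    using ex_vec_deriv_analytic[OF g(2)] by blast
  show ?thesis
    using vec_fun_form[OF fun_algebra_analytic f(2) g'(2)]
    by (simp add: res_pairing_eqI[OF f(1) g(1) vec_deriv_form[OF g'(1)]] residue_analytic)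
qed

lemma res_pairing_eps:
  assumes "regular_at z \<beta>"
  shows "res_pairing z (eps z v) \<beta> = form_deriv_at z v \<beta>"
proof -
  from assms obtain g where g: "represents \<beta> g" "g \<in> vec_fun {c. c analytic_on {z}}"
    by (auto simp: regular_at_def regular_rep_iff)
  obtain g' where g': "vec_deriv z g g'" "g' \<in> vec_fun {c. c analytic_on {z}}"
    "((\<lambda>s. form v (g s)) has_field_derivative form v (g' z)) (at z)"
    using ex_vec_deriv_analytic[OF g(2)] by blast
  have "res_pairing z (eps z v) \<beta> = residue (\<lambda>u. form v (g' u) / (u - z)) z"
    by (simp add: res_pairing_eqI[OF represents_eps g(1) vec_deriv_form[OF g'(1)]]
        form_scaleC_left)
  also have "\<dots> = form v (g' z)"
    using vec_fun_form_const[OF fun_algebra_analytic g'(2)]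
    by (intro residue_analytic_over_linear) simp
  also have "\<dots> = form_deriv_at z v \<beta>"
    using DERIV_imp_deriv[OF g'(3)] form_deriv_at_eq[of z \<beta> g v] g
    by (simp add: regular_rep_iff)
  finally show ?thesis .
qed

section \<open>Regular elements\<close>

lemma regular_atI:
  "represents \<alpha> f \<Longrightarrow> f \<in> vec_fun {c. c analytic_on {z}} \<Longrightarrow> regular_at z \<alpha>"
  by (auto simp: regular_at_def regular_rep_iff)

lemma regular_atE:
  assumes "regular_at z \<alpha>"
  obtains f where "represents \<alpha> f" "f \<in> vec_fun {c. c analytic_on {z}}"
  using assms by (auto simp: regular_at_def regular_rep_iff)

lemma regular_at_add: "regular_at z \<alpha> \<Longrightarrow> regular_at z \<beta> \<Longrightarrow> regular_at z (\<alpha> + \<beta>)"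
  by (elim regular_atE, rule regular_atI, erule (1) represents_add) (rule vec_fun.add)

lemma regular_at_scaleC: "regular_at z \<alpha> \<Longrightarrow> regular_at z (c *\<^sub>C \<alpha>)"
  by (elim regular_atE, rule regular_atI, erule represents_scaleC)
    (rule vec_fun_scaleC[OF fun_algebra_analytic])

lemma regular_at_diff: "regular_at z \<alpha> \<Longrightarrow> regular_at z \<beta> \<Longrightarrow> regular_at z (\<alpha> - \<beta>)"
  using regular_at_add[OF _ regular_at_scaleC[of z \<beta> "-1"], of \<alpha>] by (simp add: scaleC_minus_one)

lemma regular_at_lie: "regular_at z \<alpha> \<Longrightarrow> regular_at z \<beta> \<Longrightarrow> regular_at z (lie \<alpha> \<beta>)"
  by (elim regular_atE, rule regular_atI, erule (1) represents_lie)
    (rule vec_fun_lie[OF fun_algebra_analytic])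

lemma regular_rep_eps:
  assumes "z \<noteq> w"
  shows "regular_rep w (eps z v) (\<lambda>u. (1 / (u - z)) *\<^sub>C v)"
  using assms
  by (auto simp: regular_rep_iff represents_eps intro!: vec_fun.pure analytic_intros)

lemma regular_at_eps: "z \<noteq> w \<Longrightarrow> regular_at w (eps z v)"
  using regular_rep_eps regular_at_def by blast

lemma represents_unique: "represents \<alpha> f \<Longrightarrow> represents \<beta> f \<Longrightarrow> \<alpha> = \<beta>"
  by (simp add: represents_def)

lemma clinear_eps: "clinear (eps z)"
  unfolding clinear_def
proof safe
  fix v w :: 'a and c
  show "eps z (v + w) = eps z v + eps z w"
    using represents_eps[of z "v + w"] represents_add[OF represents_eps represents_eps, of z v z w]
    by (intro represents_unique) (simp_all add: scaleC_add_right)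
  show "eps z (c *\<^sub>C v) = c *\<^sub>C eps z v"
    using represents_eps[of z "c *\<^sub>C v"] represents_scaleC[OF represents_eps, of c z v]
    by (intro represents_unique) (simp_all add: scaleC_scaleC mult.commute)
qed

lemma eps_add: "eps z (v + w) = eps z v + eps z w"
  and eps_scaleC: "eps z (c *\<^sub>C v) = c *\<^sub>C eps z v"
  using clinear_eps[of z] unfolding clinear_def by blast+

lemma form_deriv_at_add:
  "regular_at z \<alpha> \<Longrightarrow> form_deriv_at z (v + w) \<alpha> = form_deriv_at z v \<alpha> + form_deriv_at z w \<alpha>"
  by (simp flip: res_pairing_eps add: eps_add res_pairing_add_left)

lemma form_deriv_at_scaleC:
  "regular_at z \<alpha> \<Longrightarrow> form_deriv_at z (c *\<^sub>C v) \<alpha> = c * form_deriv_at z v \<alpha>"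
  by (simp flip: res_pairing_eps add: eps_scaleC res_pairing_scaleC_left)

text \<open>
  A meromorphic map may be given any value at a single point.  This turns a function with a removable
  singularity into one that is holomorphic there.
\<close>

lemma point_mass_mero_vanishing: "(\<lambda>u. if u = z then 1 else 0) \<in> mero_vanishing"
proof -
  have "(\<lambda>u. if u = z then 1 else 0 :: complex) meromorphic_on UNIV \<longleftrightarrow> (\<lambda>u. 0) meromorphic_on UNIV"
    by (intro meromorphic_on_cong finite_imp_eventually_at HOL.refl) auto
  moreover have "(\<lambda>u. if inverse u = z then 1 else 0 :: complex) meromorphic_on {0} \<longleftrightarrow>
      (\<lambda>u. 0) meromorphic_on {0}"
  proof (intro meromorphic_on_cong finite_imp_eventually_at HOL.refl)
    have "{u. \<not> (if inverse u = z then 1 else 0 :: complex) = 0} \<subseteq> {inverse z}"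
      by (auto split: if_splits)
    then show "finite {u. \<not> (if inverse u = z then 1 else 0 :: complex) = 0}"
      using finite_subset by blast
  qed
  moreover have "\<forall>\<^sub>F u in at_infinity. (if u = z then 1 else 0 :: complex) = 0"
    unfolding eventually_at_infinity by (intro exI[of _ "norm z + 1"]) auto
  then have "((\<lambda>u. if u = z then 1 else 0 :: complex) \<longlongrightarrow> 0) at_infinity"
    by (rule tendsto_eventually)
  ultimately show ?thesis
    by (auto simp: mero_vanishing_def)
qed

lemma vec_fun_update:
  assumes "f \<in> vec_fun mero_vanishing"
  shows "(\<lambda>u. if u = z then y else f u) \<in> vec_fun mero_vanishing"
proof -
  have "(\<lambda>u. f u + (if u = z then 1 else 0) *\<^sub>C (y - f z)) \<in> vec_fun mero_vanishing"
    by (rule vec_fun.add[OF assms vec_fun.pure[OF point_mass_mero_vanishing]])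
  also have "(\<lambda>u. f u + (if u = z then 1 else 0) *\<^sub>C (y - f z)) = (\<lambda>u. if u = z then y else f u)"
    by (auto simp: scaleC_one)
  finally show ?thesis .
qed

lemma vec_fun_difference_quotient:
  assumes "f \<in> vec_fun {c. c analytic_on {z}}"
  shows "\<exists>y. (\<lambda>u. if u = z then y else (1 / (u - z)) *\<^sub>C (f u - f z)) \<in> vec_fun {c. c analytic_on {z}}"
  using assms
proof (induction rule: vec_fun.induct)
  case (pure c v)
  then have c: "c analytic_on {z}" by simp
  have "(\<lambda>u. if u = z then deriv c z else (c u - c z) / (u - z)) analytic_on {z}"
  proof (rule pole_theorem_analytic_0[where a = z and g = "\<lambda>u. c u - c z"])
    show "\<exists>d>0. \<forall>u\<in>ball w d - {z}.
        c u - c z = (u - z) * (if u = z then deriv c z else (c u - c z) / (u - z))" for w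
      by (rule exI[of _ 1]) auto
    show "(if z = z then deriv c z else (c z - c z) / (z - z)) = deriv (\<lambda>u. c u - c z) z"
      using c by (subst deriv_diff) (auto intro: analytic_on_imp_differentiable_at)
  qed (use c in \<open>auto intro: analytic_on_diff\<close>)
  then have "(\<lambda>u. (if u = z then deriv c z else (c u - c z) / (u - z)) *\<^sub>C v)
      \<in> vec_fun {c. c analytic_on {z}}"
    by (intro vec_fun.pure) simp
  also have "(\<lambda>u. (if u = z then deriv c z else (c u - c z) / (u - z)) *\<^sub>C v) =
     (\<lambda>u. if u = z then deriv c z *\<^sub>C v else (1 / (u - z)) *\<^sub>C (c u *\<^sub>C v - c z *\<^sub>C v))"
    by (auto simp: scaleC_scaleC simp flip: scaleC_diff_left)
  finally show ?case ..
next
  case (add f g)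
  then obtain x y where
    "(\<lambda>u. if u = z then x else (1 / (u - z)) *\<^sub>C (f u - f z)) \<in> vec_fun {c. c analytic_on {z}}"
    "(\<lambda>u. if u = z then y else (1 / (u - z)) *\<^sub>C (g u - g z)) \<in> vec_fun {c. c analytic_on {z}}"
    by blast
  from vec_fun.add[OF this]
  have "(\<lambda>u. (if u = z then x else (1 / (u - z)) *\<^sub>C (f u - f z)) +
      (if u = z then y else (1 / (u - z)) *\<^sub>C (g u - g z))) \<in> vec_fun {c. c analytic_on {z}}" .
  also have "(\<lambda>u. (if u = z then x else (1 / (u - z)) *\<^sub>C (f u - f z)) +
      (if u = z then y else (1 / (u - z)) *\<^sub>C (g u - g z))) =
      (\<lambda>u. if u = z then x + y else (1 / (u - z)) *\<^sub>C (f u + g u - (f z + g z)))"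
    by (auto simp: add_diff_add simp flip: scaleC_add_right)
  finally show ?case ..
qed

text \<open>
  If \<open>\<alpha>\<close> is regular at \<open>z\<close>, the bracket of \<open>eps z v\<close> with \<open>\<alpha>\<close> has at most a simple pole at \<open>z\<close>, with
  residue \<open>lie v (value_at z \<alpha>)\<close>; nor does subtracting its singular part create poles elsewhere.
\<close>

lemma regular_at_lie_eps_diff:
  fixes \<alpha> :: "'g::metric_lie_algebra gminus"
  assumes "regular_at z \<alpha>" "regular_at w \<alpha>"
  shows "regular_at w (lie (eps z v) \<alpha> - eps z (lie v (value_at z \<alpha>)))"
proof (cases "w = z")
  case False
  then show ?thesis
    using assms by (intro regular_at_diff regular_at_lie regular_at_eps) auto
next
  case True
  from assms(1) obtain f where f: "represents \<alpha> f" "f \<in> vec_fun {c. c analytic_on {z}}"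
    by (rule regular_atE)
  then have val: "value_at z \<alpha> = f z"
    using value_at_eq[of z \<alpha> f] by (simp add: regular_rep_iff)
  obtain y where
    "(\<lambda>u. if u = z then y else (1 / (u - z)) *\<^sub>C (f u - f z)) \<in> vec_fun {c. c analytic_on {z}}"
    using vec_fun_difference_quotient[OF f(2)] by blast
  then have "(\<lambda>u. lie v (if u = z then y else (1 / (u - z)) *\<^sub>C (f u - f z)))
      \<in> vec_fun {c. c analytic_on {z}}"
    by (rule vec_fun_lie_const)
  also have "(\<lambda>u. lie v (if u = z then y else (1 / (u - z)) *\<^sub>C (f u - f z))) =
      (\<lambda>u. if u = z then lie v y else
        lie ((1 / (u - z)) *\<^sub>C v) (f u) + (-1) *\<^sub>C (1 / (u - z)) *\<^sub>C lie v (f z))"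
      (is "_ = ?h")
    by (auto simp: lie_scaleC_left lie_scaleC_right lie_diff_right scaleC_diff_right scaleC_minus_one)
  finally have an: "?h \<in> vec_fun {c. c analytic_on {z}}" .
  have rep: "represents (lie (eps z v) \<alpha> - eps z (lie v (value_at z \<alpha>)))
      (\<lambda>u. lie ((1 / (u - z)) *\<^sub>C v) (f u) + (-1) *\<^sub>C (1 / (u - z)) *\<^sub>C lie v (f z))"
    using represents_add[OF represents_lie[OF represents_eps f(1)]
        represents_scaleC[OF represents_eps[of z "lie v (f z)"], of "-1"], of z v]
    by (simp add: val scaleC_minus_one)
  have "represents (lie (eps z v) \<alpha> - eps z (lie v (value_at z \<alpha>))) ?h"
    by (rule represents_change[OF rep vec_fun_update])
      (use rep in \<open>auto simp: represents_def intro: finite_subset[of _ "{z}"]\<close>)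
  then show ?thesis
    using an True by (auto intro: regular_atI)
qed

lemma U_reg_word_induct [consumes 1, case_names one add scaleC word]:
  assumes "x \<in> U_reg Z" "P 1"
    and "\<And>x y. x \<in> U_reg Z \<Longrightarrow> y \<in> U_reg Z \<Longrightarrow> P x \<Longrightarrow> P y \<Longrightarrow> P (x + y)"
    and "\<And>c x. x \<in> U_reg Z \<Longrightarrow> P x \<Longrightarrow> P (c *\<^sub>C x)"
    and "\<And>\<alpha> x. (\<And>z. z \<in> Z \<Longrightarrow> regular_at z \<alpha>) \<Longrightarrow> x \<in> U_reg Z \<Longrightarrow> P x \<Longrightarrow> P (Gen \<alpha> * x)"
  shows "P x"
  using assms unfolding U_reg_def by (rule uea_sub_word_induct) auto

lemma U_reg_one [simp]: "1 \<in> U_reg Z"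
  and U_reg_add: "x \<in> U_reg Z \<Longrightarrow> y \<in> U_reg Z \<Longrightarrow> x + y \<in> U_reg Z"
  and U_reg_diff: "x \<in> U_reg Z \<Longrightarrow> y \<in> U_reg Z \<Longrightarrow> x - y \<in> U_reg Z"
  and U_reg_mult: "x \<in> U_reg Z \<Longrightarrow> y \<in> U_reg Z \<Longrightarrow> x * y \<in> U_reg Z"
  and U_reg_scaleC: "x \<in> U_reg Z \<Longrightarrow> c *\<^sub>C x \<in> U_reg Z"
  and U_reg_Gen: "(\<And>z. z \<in> Z \<Longrightarrow> regular_at z \<alpha>) \<Longrightarrow> Gen \<alpha> \<in> U_reg Z"
  by (auto simp: U_reg_def uea_sub_one intro: uea_sub.intros uea_sub_diff uea_sub_scaleC)

lemma U_reg_antimono: "Z \<subseteq> Z' \<Longrightarrow> x \<in> U_reg Z' \<Longrightarrow> x \<in> U_reg Z"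
  using uea_sub_mono[of "{\<alpha>. \<forall>z\<in>Z'. regular_at z \<alpha>}" "{\<alpha>. \<forall>z\<in>Z. regular_at z \<alpha>}"]
  by (auto simp: U_reg_def)

section \<open>Existence and uniqueness of the operators\<close>

text \<open>
  The restriction to \<open>U_reg {z}\<close> of the action of the simple pole \<open>v / (u - z)\<close>, placed at \<open>z\<close> only.
\<close>

lemma ex_local_action:
  obtains J :: "'g::metric_lie_algebra \<Rightarrow> 'g gminus uea \<Rightarrow> 'g gminus uea"
  where "\<And>v. J v 1 = Gen (eps z v)" "\<And>v. clinear (J v)"
    "\<And>v \<alpha> x. regular_at z \<alpha> \<Longrightarrow> x \<in> U_reg {z} \<Longrightarrow>
      J v (Gen \<alpha> * x) = Gen \<alpha> * J v x + J (lie v (value_at z \<alpha>)) x - form_deriv_at z v \<alpha> *\<^sub>C x"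
proof -
  define p where "p X = Gen (eps z (vec_residue z X))" for X :: "'g gminus"
  \<comment> \<open>Any linear \<open>p\<close> serves that vanishes on regular elements and is \<open>Gen\<close> on each \<open>eps z v\<close>.\<close>
  have p: "clinear p"
    using clinear_vec_residue[of z, where 'a = 'g]
    by (simp add: p_def clinear_def eps_add eps_scaleC Gen_add Gen_scaleC)
  obtain D where D: "\<And>X. D X 1 = p X" "\<And>X. clinear (D X)" "\<And>x. clinear (\<lambda>X. D X x)"
    "\<And>X a x. D X (Gen a * x) = Gen a * D X x + D (lie X a) x + (- res_pairing z X a) *\<^sub>C x"
  proof (rule uea_recursion[of "\<lambda>X a. - res_pairing z X a", OF _ _ _ _ _ p])
  qed (simp_all add: res_pairing_add_left res_pairing_add_right res_pairing_scaleC_left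
        res_pairing_scaleC_right res_pairing_cocycle, blast)
  \<comment> \<open>Both \<open>p\<close> and the pairing of regular elements vanish, and brackets of these are regular.\<close>
  have zero: "\<forall>X. regular_at z X \<longrightarrow> D X x = 0" if "x \<in> U_reg {z}" for x
    using that
  proof (induction rule: U_reg_word_induct)
    case one
    then show ?case
      using eps_scaleC[of z 0 "0::'g"] by (simp add: D p_def vec_residue_regular)
  next
    case (add x y)
    then show ?case using D(2) by (simp add: clinear_def)
  next
    case (scaleC c x)
    then show ?case using D(2) by (simp add: clinear_def)
  next
    case (word \<alpha> x)
    then show ?case by (simp add: D(4) regular_at_lie res_pairing_regular)
  qed
  show thesis
  proof (rule that[of "\<lambda>v. D (eps z v)"])
    fix v :: 'g and \<alpha> :: "'g gminus" and x :: "'g gminus uea"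
    assume \<alpha>: "regular_at z \<alpha>" and x: "x \<in> U_reg {z}"
    let ?R = "lie (eps z v) \<alpha> - eps z (lie v (value_at z \<alpha>))"
    have "D ?R x = 0"
      using zero[OF x] regular_at_lie_eps_diff[OF \<alpha> \<alpha>] by blast
    moreover have "D (eps z (lie v (value_at z \<alpha>)) + ?R) x = D (eps z (lie v (value_at z \<alpha>))) x + D ?R x"
      using D(3)[of x] unfolding clinear_def by blast
    ultimately have "D (lie (eps z v) \<alpha>) x = D (eps z (lie v (value_at z \<alpha>))) x"
      by simp
    then show "D (eps z v) (Gen \<alpha> * x) = Gen \<alpha> * D (eps z v) x +
        D (eps z (lie v (value_at z \<alpha>))) x - form_deriv_at z v \<alpha> *\<^sub>C x"
      by (simp add: D(4) res_pairing_eps[OF \<alpha>] scaleC_minus_left)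
  qed (simp_all add: D p_def vec_residue_eps)
qed

lemma ex_iota_family: "\<exists>I. iota_family z (I :: 'g::metric_lie_algebra \<Rightarrow> _)"
proof -
  obtain J :: "'g \<Rightarrow> 'g gminus uea \<Rightarrow> 'g gminus uea" where J: "\<And>v. J v 1 = Gen (eps z v)"
    "\<And>v. clinear (J v)"
    "\<And>v \<alpha> x. regular_at z \<alpha> \<Longrightarrow> x \<in> U_reg {z} \<Longrightarrow>
      J v (Gen \<alpha> * x) = Gen \<alpha> * J v x + J (lie v (value_at z \<alpha>)) x - form_deriv_at z v \<alpha> *\<^sub>C x"
    by (rule ex_local_action[of z]) blast
  define I where "I v x = (if x \<in> U_reg {z} then J v x - Gen (eps z v) * x else 0)" for v x
  have J_add: "J v (x + y) = J v x + J v y" and J_scaleC: "J v (c *\<^sub>C x) = c *\<^sub>C J v x" for v c x y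
    using J(2) by (auto simp: clinear_def)
  have add: "I v (x + y) = I v x + I v y" if "x \<in> U_reg {z}" "y \<in> U_reg {z}" for v x y
    using that by (simp add: I_def U_reg_add J_add algebra_simps)
  have scaleC: "I v (c *\<^sub>C x) = c *\<^sub>C I v x" if "x \<in> U_reg {z}" for v c x
    using that by (simp add: I_def U_reg_scaleC J_scaleC uea_scaleC_mult_right scaleC_diff_right)
  have commutator: "I v (Gen \<alpha> * x) - Gen \<alpha> * I v x =
      - (Gen (lie (eps z v) \<alpha>) * x) - form_deriv_at z v \<alpha> *\<^sub>C x
      + I (lie v (value_at z \<alpha>)) x + epsilon z (lie v (value_at z \<alpha>)) x"
    if "regular_at z \<alpha>" "x \<in> U_reg {z}" for v \<alpha> x
  proof -
    have "Gen \<alpha> * x \<in> U_reg {z}"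
      using that by (auto intro!: U_reg_mult U_reg_Gen)
    then show ?thesis
      using that by (simp add: I_def J(3) Gen_lie epsilon_def algebra_simps)
  qed
  have closed: "\<forall>v. I v x \<in> U_reg {z}" if "x \<in> U_reg {z}" for x
    using that
  proof (induction rule: U_reg_word_induct)
    case one
    then show ?case using U_reg_scaleC[of 1 "{z}" 0] by (simp add: I_def J)
  next
    case (word \<alpha> x)
    show ?case
    proof
      fix v
      let ?R = "lie (eps z v) \<alpha> - eps z (lie v (value_at z \<alpha>))"
      have "I v (Gen \<alpha> * x) = Gen \<alpha> * I v x - Gen ?R * x - form_deriv_at z v \<alpha> *\<^sub>C x
          + I (lie v (value_at z \<alpha>)) x"
        using commutator[of \<alpha> x v] word
        by (simp add: Gen_diff epsilon_def algebra_simps)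
      moreover have "Gen ?R \<in> U_reg {z}" "Gen \<alpha> \<in> U_reg {z}"
        using word regular_at_lie_eps_diff by (auto intro!: U_reg_Gen)
      ultimately show "I v (Gen \<alpha> * x) \<in> U_reg {z}"
        using word by (auto intro!: U_reg_add U_reg_diff U_reg_mult U_reg_scaleC)
    qed
  qed (simp_all add: add scaleC U_reg_add U_reg_scaleC)
  have "iota_family z I"
    unfolding iota_family_def using add scaleC commutator closed by (auto simp: I_def J)
  then show ?thesis by blast
qed

lemma iota_familyD:
  assumes "iota_family z I"
  shows "x \<in> U_reg {z} \<Longrightarrow> I v x \<in> U_reg {z}"
    and "x \<in> U_reg {z} \<Longrightarrow> y \<in> U_reg {z} \<Longrightarrow> I v (x + y) = I v x + I v y"
    and "x \<in> U_reg {z} \<Longrightarrow> I v (c *\<^sub>C x) = c *\<^sub>C I v x"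
    and "I v 1 = 0"
    and "regular_at z \<alpha> \<Longrightarrow> x \<in> U_reg {z} \<Longrightarrow> I v (Gen \<alpha> * x) - Gen \<alpha> * I v x =
          - (Gen (lie (eps z v) \<alpha>) * x) - form_deriv_at z v \<alpha> *\<^sub>C x
          + I (lie v (value_at z \<alpha>)) x + epsilon z (lie v (value_at z \<alpha>)) x"
    and "x \<notin> U_reg {z} \<Longrightarrow> I v x = 0"
  using assms unfolding iota_family_def by blast+

lemma iota_family_unique:
  assumes I: "iota_family z I" and I': "iota_family z I'"
  shows "I = I'"
proof (intro ext)
  fix v x
  show "I v x = I' v x"
  proof (cases "x \<in> U_reg {z}")
    case True
    then have "\<forall>v. I v x = I' v x"
    proof (induction rule: U_reg_word_induct)
      case (word \<alpha> x)
      then have \<alpha>: "regular_at z \<alpha>" by simp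
      have "I v (Gen \<alpha> * x) = I' v (Gen \<alpha> * x)" for v
        using iota_familyD(5)[OF I \<alpha> word(2), of v] iota_familyD(5)[OF I' \<alpha> word(2), of v] word(3)
        by (metis diff_add_cancel)
      then show ?case by blast
    qed (simp_all add: iota_familyD(2,3,4)[OF I] iota_familyD(2,3,4)[OF I'])
    then show ?thesis by blast
  qed (simp add: iota_familyD(6)[OF I] iota_familyD(6)[OF I'])
qed

lemma iota_family_iota: "iota_family z (iota z)"
proof -
  have "\<exists>!I. iota_family z (I :: 'g::metric_lie_algebra \<Rightarrow> _)"
    using ex_iota_family[of z] iota_family_unique by blast
  then show ?thesis
    unfolding iota_def by (rule theI')
qed

section \<open>Properties of the operators\<close>

lemma iota_closed_point: "x \<in> U_reg {z} \<Longrightarrow> iota z v x \<in> U_reg {z}"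
  and iota_add: "x \<in> U_reg {z} \<Longrightarrow> y \<in> U_reg {z} \<Longrightarrow> iota z v (x + y) = iota z v x + iota z v y"
  and iota_scaleC: "x \<in> U_reg {z} \<Longrightarrow> iota z v (c *\<^sub>C x) = c *\<^sub>C iota z v x"
  and iota_one: "iota z v 1 = 0"
  using iota_familyD(1-4)[OF iota_family_iota] by blast+

lemma iota_Gen_mult:
  assumes "regular_at z \<alpha>" "x \<in> U_reg {z}"
  shows "iota z v (Gen \<alpha> * x) = Gen \<alpha> * iota z v x - Gen (lie (eps z v) \<alpha>) * x
    - form_deriv_at z v \<alpha> *\<^sub>C x + iota z (lie v (value_at z \<alpha>)) x
    + epsilon z (lie v (value_at z \<alpha>)) x"
  using iota_familyD(5)[OF iota_family_iota assms, of v] by (simp add: algebra_simps)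

lemma iota_add_left:
  assumes "x \<in> U_reg {z}"
  shows "iota z (v + w) x = iota z v x + iota z w x"
proof -
  from assms have "\<forall>v w. iota z (v + w) x = iota z v x + iota z w x"
  proof (induction rule: U_reg_word_induct)
    case (word \<alpha> x)
    then show ?case
      by (simp add: iota_Gen_mult lie_add_left eps_add Gen_add form_deriv_at_add epsilon_def
          algebra_simps scaleC_add_left)
  qed (simp_all add: iota_one iota_add iota_scaleC scaleC_add_right)
  then show ?thesis by blast
qed

lemma iota_scaleC_left:
  assumes "x \<in> U_reg {z}"
  shows "iota z (a *\<^sub>C v) x = a *\<^sub>C iota z v x"
proof -
  from assms have "\<forall>v a. iota z (a *\<^sub>C v) x = a *\<^sub>C iota z v x"
  proof (induction rule: U_reg_word_induct)
    case (word \<alpha> x)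
    then show ?case
      by (simp add: iota_Gen_mult lie_scaleC_left eps_scaleC Gen_scaleC form_deriv_at_scaleC
          epsilon_def scaleC_add_right scaleC_diff_right uea_scaleC_mult_left uea_scaleC_mult_right
          scaleC_scaleC)
  next
    case (scaleC c x)
    then show ?case by (simp add: iota_scaleC scaleC_scaleC mult.commute)
  qed (simp_all add: iota_one iota_add scaleC_add_right)
  then show ?thesis by blast
qed

text \<open>The operators create no poles at further points.\<close>

lemma iota_closed:
  assumes "x \<in> U_reg Z" "z \<in> Z"
  shows "iota z v x \<in> U_reg Z"
proof -
  have U: "x \<in> U_reg {z}" if "x \<in> U_reg Z" for x :: "'a gminus uea"
    using U_reg_antimono[of "{z}" Z] that assms(2) by auto
  from assms(1) have "\<forall>v. iota z v x \<in> U_reg Z"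
  proof (induction rule: U_reg_word_induct)
    case one
    show ?case using U_reg_scaleC[of 1 Z 0] by (simp add: iota_one)
  next
    case (word \<alpha> x)
    show ?case
    proof
      fix v
      let ?R = "lie (eps z v) \<alpha> - eps z (lie v (value_at z \<alpha>))"
      have "iota z v (Gen \<alpha> * x) = Gen \<alpha> * iota z v x - Gen ?R * x - form_deriv_at z v \<alpha> *\<^sub>C x
          + iota z (lie v (value_at z \<alpha>)) x"
        using word assms(2) U[of x]
        by (simp add: iota_Gen_mult Gen_diff epsilon_def algebra_simps)
      moreover have "Gen ?R \<in> U_reg Z" "Gen \<alpha> \<in> U_reg Z"
        using word(1) assms(2) by (auto intro!: U_reg_Gen regular_at_lie_eps_diff)
      ultimately show "iota z v (Gen \<alpha> * x) \<in> U_reg Z"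
        using word by (auto intro!: U_reg_add U_reg_diff U_reg_mult U_reg_scaleC)
    qed
  qed (simp_all add: U iota_add iota_scaleC U_reg_add U_reg_scaleC)
  then show ?thesis by blast
qed

section \<open>Commutation of currents\<close>

lemma current_add:
  "x \<in> U_reg {z} \<Longrightarrow> y \<in> U_reg {z} \<Longrightarrow> current z v (x + y) = current z v x + current z v y"
  by (simp add: current_def epsilon_def iota_add algebra_simps)

lemma current_scaleC: "x \<in> U_reg {z} \<Longrightarrow> current z v (c *\<^sub>C x) = c *\<^sub>C current z v x"
  by (simp add: current_def epsilon_def iota_scaleC uea_scaleC_mult_right scaleC_add_right)

lemma current_scaleC_left: "x \<in> U_reg {z} \<Longrightarrow> current z (c *\<^sub>C v) x = c *\<^sub>C current z v x"
  by (simp add: current_def epsilon_def iota_scaleC_left eps_scaleC Gen_scaleC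
      uea_scaleC_mult_left scaleC_add_right)

lemma current_add_left: "x \<in> U_reg {z} \<Longrightarrow> current z (v + w) x = current z v x + current z w x"
  by (simp add: current_def epsilon_def iota_add_left eps_add Gen_add algebra_simps)

lemma current_one: "current z v 1 = Gen (eps z v)"
  by (simp add: current_def epsilon_def iota_one)

lemma current_Gen_mult:
  assumes "regular_at z \<alpha>" "x \<in> U_reg {z}"
  shows "current z v (Gen \<alpha> * x) = Gen \<alpha> * current z v x + current z (lie v (value_at z \<alpha>)) x
    - form_deriv_at z v \<alpha> *\<^sub>C x"
  using assms by (simp add: current_def iota_Gen_mult epsilon_def Gen_lie algebra_simps)

lemma current_closed:
  assumes "x \<in> U_reg Z" "z \<in> Z" "Y \<subseteq> Z - {z}"
  shows "current z v x \<in> U_reg Y"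
proof -
  have "Y \<subseteq> Z" using assms(3) by auto
  then have "x \<in> U_reg Y" "iota z v x \<in> U_reg Y"
    using iota_closed[OF assms(1,2)] assms(1) by (auto intro: U_reg_antimono)
  then show ?thesis
    unfolding current_def epsilon_def
    by (intro U_reg_add U_reg_mult U_reg_Gen regular_at_eps) (use assms(3) in auto)
qed

lemma current_closed2: "z1 \<noteq> z2 \<Longrightarrow> x \<in> U_reg {z1, z2} \<Longrightarrow> current z1 v x \<in> U_reg {z2}"
  by (rule current_closed) auto

lemma value_at_eps: "z \<noteq> w \<Longrightarrow> value_at w (eps z (v::'g::metric_lie_algebra)) = (1 / (w - z)) *\<^sub>C v"
  using value_at_eq[OF regular_rep_eps, of z w v] by simp

lemma form_deriv_at_eps:
  assumes "z \<noteq> w"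
  shows "form_deriv_at w v (eps z v') = - form v v' / (w - z)\<^sup>2"
proof -
  have "((\<lambda>u. form v v' / (u - z)) has_field_derivative - form v v' / (w - z)\<^sup>2) (at w)"
    using assms by (auto intro!: derivative_eq_intros simp: power2_eq_square)
  then have "deriv (\<lambda>u. form v v' / (u - z)) w = - form v v' / (w - z)\<^sup>2"
    by (rule DERIV_imp_deriv)
  then show ?thesis
    using form_deriv_at_eq[OF regular_rep_eps[OF assms], of v v'] by (simp add: form_scaleC_right)
qed

lemma lie_eps_eps:
  assumes "z1 \<noteq> z2"
  shows "lie (eps z1 v1) (eps z2 v2) = (1 / (z1 - z2)) *\<^sub>C (eps z1 (lie v1 v2) - eps z2 (lie v1 v2))"
proof -
  let ?l = "\<lambda>u. lie ((1 / (u - z1)) *\<^sub>C v1) ((1 / (u - z2)) *\<^sub>C v2)"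
  let ?r = "\<lambda>u. (1 / (z1 - z2)) *\<^sub>C ((1 / (u - z1)) *\<^sub>C lie v1 v2 + (-1) *\<^sub>C (1 / (u - z2)) *\<^sub>C lie v1 v2)"
  have l: "represents (lie (eps z1 v1) (eps z2 v2)) ?l"
    by (intro represents_lie represents_eps)
  have r: "represents ((1 / (z1 - z2)) *\<^sub>C (eps z1 (lie v1 v2) + (-1) *\<^sub>C eps z2 (lie v1 v2))) ?r"
    by (intro represents_scaleC represents_add represents_eps)
  have "?l u = ?r u" if "u \<noteq> z1" "u \<noteq> z2" for u
  proof -
    have "1 / (u - z2) * (1 / (u - z1)) = 1 / (z1 - z2) * (1 / (u - z1) + (-1) * (1 / (u - z2)))"
      using that assms by (simp add: divide_simps)
    then show ?thesis
      by (simp only: lie_scaleC_left lie_scaleC_right scaleC_scaleC flip: scaleC_add_left)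
  qed
  then have "{u. ?l u \<noteq> ?r u} \<subseteq> {z1, z2}"
    by blast
  then have "finite {u. ?l u \<noteq> ?r u}"
    by (rule finite_subset) simp
  then have "lie (eps z1 v1) (eps z2 v2) =
      (1 / (z1 - z2)) *\<^sub>C (eps z1 (lie v1 v2) + (-1) *\<^sub>C eps z2 (lie v1 v2))"
    by (rule represents_eq_iff[OF l r, THEN iffD2])
  then show ?thesis
    by (simp add: scaleC_minus_one)
qed

lemma current_commute:
  assumes z: "z1 \<noteq> z2" and x: "x \<in> U_reg {z1, z2}"
  shows "current z1 v1 (current z2 v2 x) = current z2 v2 (current z1 v1 x)"
proof -
  have U: "x \<in> U_reg {z1}" "x \<in> U_reg {z2}" if "x \<in> U_reg {z1, z2}" for x :: "'a gminus uea"
    using U_reg_antimono[of "{z1}" "{z1, z2}"] U_reg_antimono[of "{z2}" "{z1, z2}"] that by auto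
  have U1: "current z1 v x \<in> U_reg {z2}" if "x \<in> U_reg {z1, z2}" for x :: "'a gminus uea" and v
    using current_closed2[OF z that] .
  have U2: "current z2 v x \<in> U_reg {z1}" if "x \<in> U_reg {z1, z2}" for x :: "'a gminus uea" and v
    using current_closed2[of z2 z1 x v] z that by (simp add: insert_commute)
  from x have "\<forall>v1 v2. current z1 v1 (current z2 v2 x) = current z2 v2 (current z1 v1 x)"
  proof (induction rule: U_reg_word_induct)
    case one
    have "current z1 v1 (Gen (eps z2 v2)) = current z2 v2 (Gen (eps z1 v1))" for v1 v2 :: 'a
    proof -
      have l: "current z1 v1 (Gen (eps z2 v2)) = Gen (eps z2 v2) * Gen (eps z1 v1)
          + (1 / (z1 - z2)) *\<^sub>C Gen (eps z1 (lie v1 v2)) + (form v1 v2 / (z1 - z2)\<^sup>2) *\<^sub>C 1"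
        using current_Gen_mult[OF regular_at_eps[of z2 z1 v2] U_reg_one, of v1] z
        by (simp add: current_one value_at_eps form_deriv_at_eps lie_scaleC_right eps_scaleC
            Gen_scaleC scaleC_minus_left)
      have "current z2 v2 (Gen (eps z1 v1)) = Gen (eps z1 v1) * Gen (eps z2 v2)
          + (1 / (z2 - z1)) *\<^sub>C Gen (eps z2 (lie v2 v1)) + (form v2 v1 / (z2 - z1)\<^sup>2) *\<^sub>C 1"
        using current_Gen_mult[OF regular_at_eps[of z1 z2 v1] U_reg_one, of v2] z
        by (simp add: current_one value_at_eps form_deriv_at_eps lie_scaleC_right eps_scaleC
            Gen_scaleC scaleC_minus_left)
      moreover have "eps z2 (lie v2 v1) = (-1) *\<^sub>C eps z2 (lie v1 v2)"
        by (metis eps_scaleC lie_anticomm scaleC_minus_one)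
      then have "(1 / (z2 - z1)) *\<^sub>C Gen (eps z2 (lie v2 v1)) = (1 / (z1 - z2)) *\<^sub>C Gen (eps z2 (lie v1 v2))"
        using minus_divide_right[of 1 "z2 - z1"] by (simp add: Gen_scaleC scaleC_scaleC)
      moreover have "form v2 v1 / (z2 - z1)\<^sup>2 = form v1 v2 / (z1 - z2)\<^sup>2"
        by (simp add: form_sym power2_commute)
      moreover have "Gen (eps z1 v1) * Gen (eps z2 v2) - Gen (eps z2 v2) * Gen (eps z1 v1) =
          (1 / (z1 - z2)) *\<^sub>C Gen (eps z1 (lie v1 v2)) - (1 / (z1 - z2)) *\<^sub>C Gen (eps z2 (lie v1 v2))"
        using lie_eps_eps[OF z, of v1 v2]
        by (simp flip: Gen_lie add: Gen_scaleC Gen_diff scaleC_diff_right)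
      ultimately show ?thesis
        unfolding l by (simp add: algebra_simps)
    qed
    then show ?case by (simp add: current_one)
  next
    case (add x y)
    then show ?case by (simp add: current_add U U1 U2)
  next
    case (scaleC c x)
    then show ?case by (simp add: current_scaleC U U1 U2)
  next
    case (word \<alpha> x)
    then have \<alpha>: "regular_at z1 \<alpha>" "regular_at z2 \<alpha>" and x: "x \<in> U_reg {z1, z2}" by auto
    have diff: "x - y \<in> U_reg {z}" "current z v (x - y) = current z v x - current z v y"
      if "x \<in> U_reg {z}" "y \<in> U_reg {z}" for x y v z
      using current_add[of "x - y" z y v] that U_reg_diff[of x "{z}" y] by auto
    have G: "Gen \<alpha> * y \<in> U_reg {z1}" if "y \<in> U_reg {z1}" for y
      using that \<alpha> by (auto intro!: U_reg_mult U_reg_Gen)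
    have G': "Gen \<alpha> * y \<in> U_reg {z2}" if "y \<in> U_reg {z2}" for y
      using that \<alpha> by (auto intro!: U_reg_mult U_reg_Gen)
    show ?case
      using word(3) by (simp add: current_Gen_mult \<alpha> U[OF x] U1[OF x] U2[OF x] U_reg_add
          U_reg_scaleC diff current_add current_scaleC G G')
  qed
  then show ?thesis by blast
qed

section \<open>Limits in the enveloping algebra\<close>

lemma eventually_vec_fun_analytic:
  assumes "f \<in> vec_fun {c. c analytic_on {z}}"
  shows "\<forall>\<^sub>F w in nhds z. f \<in> vec_fun {c. c analytic_on {w}}"
  using assms
proof (induction rule: vec_fun.induct)
  case (pure c v)
  then obtain A where A: "open A" "z \<in> A" "c holomorphic_on A"
    by (auto simp: analytic_at)
  from A(1,2) have "\<forall>\<^sub>F w in nhds z. w \<in> A"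
    by (rule eventually_nhds_in_open)
  then show ?case
    by eventually_elim (use A in \<open>auto simp: analytic_at intro!: vec_fun.pure\<close>)
next
  case (add f g)
  from add.IH show ?case
    by eventually_elim (rule vec_fun.add)
qed

lemma eventually_U_reg:
  assumes "x \<in> U_reg {z}"
  shows "\<forall>\<^sub>F w in at z. x \<in> U_reg {z, w}"
  using assms
proof (induction rule: U_reg_word_induct)
  case (word \<alpha> x)
  then have "regular_at z \<alpha>" by simp
  then obtain f where f: "represents \<alpha> f" "f \<in> vec_fun {c. c analytic_on {z}}"
    by (rule regular_atE)
  have "\<forall>\<^sub>F w in at z. f \<in> vec_fun {c. c analytic_on {w}}"
    using eventually_vec_fun_analytic[OF f(2)] by (simp add: eventually_nhds_conv_at)
  with word(3) show ?case
    by eventually_elim (use word(1) f in \<open>auto intro!: U_reg_mult U_reg_Gen intro: regular_atI\<close>)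
next
  case (add x y)
  from add(3,4) show ?case by eventually_elim (rule U_reg_add)
next
  case (scaleC c x)
  from scaleC(2) show ?case by eventually_elim (rule U_reg_scaleC)
qed simp

lemma uea_tendsto_scaleC:
  assumes "(c \<longlongrightarrow> l) F" "uea_tendsto F f a"
  shows "uea_tendsto F (\<lambda>w. c w *\<^sub>C f w) (l *\<^sub>C a)"
  using uea_tendsto.mul[OF uea_tendsto.scal[OF assms(1)] assms(2)]
  by (simp add: uea_scaleC_mult_left)

lemma mero_vanishing_finite_singularities:
  assumes "c \<in> mero_vanishing"
  obtains S where "finite S" "c analytic_on (- S)"
proof -
  have mero: "c meromorphic_on UNIV" "(\<lambda>t. c (inverse t)) meromorphic_on {0}"
    using assms by (auto simp: mero_vanishing_def)
  from mero(2) have "\<forall>\<^sub>F t in at 0. (\<lambda>t. c (inverse t)) analytic_on {t}"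
    by (intro isolated_singularity_at_altdef[THEN iffD1] meromorphic_on_isolated_singularity)
  then obtain r where r: "r > 0" "\<And>t. t \<noteq> 0 \<Longrightarrow> norm t < r \<Longrightarrow> (\<lambda>t. c (inverse t)) analytic_on {t}"
    by (auto simp: eventually_at dist_norm)
  define S where "S = {u. \<not> c analytic_on {u}}"
  \<comment> \<open>\<open>P\<close> is at most an isolated singularity, so that all others lie in a compact disc.\<close>
  have "S \<subseteq> cball 0 (1 / r)"
  proof
    fix u assume u: "u \<in> S"
    show "u \<in> cball 0 (1 / r)"
    proof (rule ccontr)
      assume "u \<notin> cball 0 (1 / r)"
      then have u1: "1 / r < norm u" by simp
      then have u0: "norm u > 0"
        using r(1) by (auto intro: less_trans[OF divide_pos_pos[of 1 r]])
      with u1 r(1) have "1 / norm u < r"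
        by (simp add: field_simps)
      then have "norm (inverse u) < r"
        by (simp add: norm_inverse divide_inverse)
      with u0 have "u \<noteq> 0" "(\<lambda>t. c (inverse t)) analytic_on {inverse u}"
        using r(2)[of "inverse u"] by auto
      then have "((\<lambda>t. c (inverse t)) \<circ> inverse) analytic_on {u}"
        by (intro analytic_on_compose) (auto intro!: analytic_intros)
      then show False using u by (simp add: S_def o_def)
    qed
  qed
  moreover have "S sparse_in UNIV"
    using meromorphic_on_imp_analytic_cosparse[OF mero(1)] by (simp add: S_def eventually_cosparse)
  then have "S sparse_in cball 0 (1 / r)"
    by (rule sparse_in_subset) simp
  ultimately have "finite S"
    using sparse_in_compact_finite[of S "cball 0 (1 / r)"] by (simp add: Int_absorb1)
  moreover have "c analytic_on (- S)"
    unfolding S_def by (subst analytic_on_analytic_at) auto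
  ultimately show thesis by (rule that)
qed

lemma mero_vanishing_bounded:
  assumes c: "c \<in> mero_vanishing" and N: "open N" "c analytic_on (- N)"
  obtains M where "\<And>u. u \<notin> N \<Longrightarrow> norm (c u) \<le> M"
proof -
  have "(c \<longlongrightarrow> 0) at_infinity"
    using c by (simp add: mero_vanishing_def)
  then have "\<forall>\<^sub>F u in at_infinity. norm (c u) < 1"
    using tendstoD[of c 0 at_infinity 1] by simp
  then obtain B where B: "\<And>u. B \<le> norm u \<Longrightarrow> norm (c u) < 1"
    by (auto simp: eventually_at_infinity)
  have "compact ((- N) \<inter> cball 0 B)"
    using N(1) by (intro closed_Int_compact) auto
  moreover have "continuous_on ((- N) \<inter> cball 0 B) c"
    using N(2) by (intro holomorphic_on_imp_continuous_on analytic_imp_holomorphic)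
      (rule analytic_on_subset, auto)
  ultimately have "bounded (c ` ((- N) \<inter> cball 0 B))"
    by (intro compact_imp_bounded compact_continuous_image)
  then obtain M where "\<forall>u \<in> (- N) \<inter> cball 0 B. norm (c u) \<le> M"
    by (auto simp: bounded_iff)
  then have M: "\<And>u. u \<notin> N \<Longrightarrow> norm u \<le> B \<Longrightarrow> norm (c u) \<le> M"
    by simp
  show thesis
  proof (rule that[of "max M 1"])
    fix u assume "u \<notin> N"
    then show "norm (c u) \<le> max M 1"
      using M[of u] B[of u] by (cases "norm u \<le> B") (auto simp: max_def)
  qed
qed

lemma uea_tendsto_const: "uea_tendsto F (\<lambda>_. a) (a :: 'g::complex_lie_algebra gminus uea)"
proof -
  have const: "uea_tendsto F (\<lambda>_. Gen (abs_gminus f)) (Gen (abs_gminus f))"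
    if "f \<in> vec_fun mero_vanishing" for f :: "complex \<Rightarrow> 'g"
    using that
  proof (induction rule: vec_fun.induct)
    case (pure c v)
    obtain S where "finite S" "c analytic_on (- S)"
      using mero_vanishing_finite_singularities[OF pure] .
    then have "c analytic_on (- N)" if "S \<subseteq> N" for N
      using that by (auto intro: analytic_on_subset)
    then have "mero_tendsto (\<lambda>_. c) c F"
      using pure \<open>finite S\<close> unfolding mero_tendsto_def
      by (intro conjI exI[of _ S]) (auto intro: uniform_limit_const)
    from uea_tendsto.gen[OF this, of v] show ?case
      by (simp add: pure_map_def)
  next
    case (add f g)
    then have "abs_gminus (\<lambda>u. f u + g u) = abs_gminus f + abs_gminus g"
      by (simp add: plus_gminus.abs_eq mero_rel_refl)
    then show ?case
      using uea_tendsto.add[OF add.IH] by (simp add: Gen_add)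
  qed
  have Gen: "uea_tendsto F (\<lambda>_. Gen \<alpha>) (Gen \<alpha>)" for \<alpha> :: "'g gminus"
    using ex_represents[of \<alpha>] const by (auto simp: represents_def)
  have "uea_tendsto F (\<lambda>_. abs_uea s) (abs_uea s)" for s :: "'g gminus uea_term"
  proof (induction s)
    case (TScal c)
    show ?case by (simp add: abs_uea_TScal uea_tendsto.scal)
  next
    case (TGen \<alpha>)
    show ?case using Gen[of \<alpha>] by (simp add: Gen.abs_eq)
  next
    case (TAdd s t)
    then show ?case using uea_tendsto.add[OF TAdd] by (simp add: plus_uea.abs_eq)
  next
    case (TMul s t)
    then show ?case using uea_tendsto.mul[OF TMul] by (simp add: times_uea.abs_eq)
  qed
  from this[of "rep_uea a"] show ?thesis
    using Quotient3_abs_rep[OF Quotient3_uea] by metis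
qed

text \<open>
  The case \<open>h = 1\<close>, not vanishing at \<open>P\<close>, is included for the sake of \<open>eps\<close> itself.
\<close>

lemma mero_tendsto_over_linear:
  assumes h: "h = (\<lambda>_. 1) \<or> h \<in> mero_vanishing"
  shows "mero_tendsto (\<lambda>w u. h u / (u - w)) (\<lambda>u. h u / (u - z)) (at z)"
proof -
  have van: "(\<lambda>u. h u / (u - w)) \<in> mero_vanishing" for w
    using h linear_pole_mero_vanishing[of w] mult_mero_vanishing[of h, OF _ linear_pole_mero_vanishing[of w]]
    by auto
  obtain S where S: "finite S" "h analytic_on (- S)"
    using h mero_vanishing_finite_singularities[of h] by (metis analytic_on_const finite.emptyI)
  have "(\<forall>\<^sub>F w in at z. (\<lambda>u. h u / (u - w)) analytic_on - N) \<and> (\<lambda>u. h u / (u - z)) analytic_on - N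
      \<and> uniform_limit (- N) (\<lambda>w u. h u / (u - w)) (\<lambda>u. h u / (u - z)) (at z)"
    if N: "open N" "insert z S \<subseteq> N" for N
  proof -
    have hN: "h analytic_on (- N)"
      using S(2) N(2) by (auto intro: analytic_on_subset)
    obtain M where M: "\<And>u. u \<notin> N \<Longrightarrow> norm (h u) \<le> M"
      using h mero_vanishing_bounded[OF _ N(1) hN] by (metis norm_one order_refl)
    obtain r where r: "r > 0" "ball z r \<subseteq> N"
      using N openE by blast
    have an: "(\<lambda>u. h u / (u - w)) analytic_on - N" if "w \<in> N" for w
      using that by (intro analytic_intros hN) auto
    have far: "r \<le> norm (u - z)" if "u \<notin> N" for u
      using that r(2) by (auto simp: dist_norm norm_minus_commute subset_iff not_less[symmetric])
    have near: "\<forall>\<^sub>F w in at z. norm (w - z) < e" if "e > 0" for e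
      using that unfolding eventually_at by (auto simp: dist_norm)
    have "uniform_limit (- N) (\<lambda>w u. h u / (u - w)) (\<lambda>u. h u / (u - z)) (at z)"
    proof (rule uniform_limitI)
      fix e :: real assume "e > 0"
      define K where "K = \<bar>M\<bar> + 1"
      define e' where "e' = e * r\<^sup>2 / (2 * K)"
      have "K > 0" unfolding K_def by simp
      have "e' > 0" unfolding e'_def using \<open>e > 0\<close> \<open>K > 0\<close> r(1) by simp
      with near[of "r / 2"] near[of e'] r(1)
      have "\<forall>\<^sub>F w in at z. norm (w - z) < r / 2 \<and> norm (w - z) < e'"
        by (simp add: eventually_conj)
      then show "\<forall>\<^sub>F w in at z. \<forall>u\<in>- N. dist (h u / (u - w)) (h u / (u - z)) < e"
      proof eventually_elim
        case (elim w)
        show ?case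
        proof
          fix u assume "u \<in> - N"
          then have u: "r \<le> norm (u - z)" "norm (h u) \<le> K"
            using far[of u] M[of u] by (auto simp: K_def)
          moreover have "norm (u - z) \<le> norm (u - w) + norm (w - z)"
            using norm_triangle_ineq[of "u - w" "w - z"] by simp
          ultimately have uw: "r / 2 \<le> norm (u - w)"
            using elim by linarith
          then have "u - w \<noteq> 0" "u - z \<noteq> 0" using u r(1) by auto
          then have "h u / (u - w) - h u / (u - z) = h u * (w - z) / ((u - w) * (u - z))"
            by (simp add: field_simps)
          then have "dist (h u / (u - w)) (h u / (u - z)) =
              norm (h u) * norm (w - z) / (norm (u - w) * norm (u - z))"
            by (simp add: dist_norm norm_mult norm_divide)
          also have "\<dots> \<le> K * norm (w - z) / (r / 2 * r)"
            using u uw \<open>K > 0\<close> r(1) by (intro frac_le mult_mono mult_right_mono) auto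
          also have "\<dots> < K * e' / (r / 2 * r)"
            using elim \<open>K > 0\<close> r(1) by (intro divide_strict_right_mono mult_strict_left_mono) auto
          also have "\<dots> = e"
            using \<open>K > 0\<close> r(1) unfolding e'_def by (simp add: power2_eq_square field_simps)
          finally show "dist (h u / (u - w)) (h u / (u - z)) < e" .
        qed
      qed
    qed
    moreover have "\<forall>\<^sub>F w in at z. w \<in> N"
      using N by (intro eventually_at_in_open') auto
    then have "\<forall>\<^sub>F w in at z. (\<lambda>u. h u / (u - w)) analytic_on - N"
      by eventually_elim (rule an)
    ultimately show ?thesis
      using an[of z] N(2) by auto
  qed
  then show ?thesis
    unfolding mero_tendsto_def using van S(1)
    by (intro conjI allI exI[of _ "insert z S"]) auto
qed

section \<open>Differentiable families\<close>

text \<open>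
  Differentiability at \<open>z\<close> of a family of elements of the enveloping algebra, with respect to
  \<open>uea_tendsto\<close>; \<open>iota_has_deriv\<close> is the instance \<open>f w = iota w v x\<close>.
\<close>

definition uea_differentiable :: "complex \<Rightarrow> (complex \<Rightarrow> 'g::complex_lie_algebra gminus uea) \<Rightarrow> bool" where
  "uea_differentiable z f \<longleftrightarrow> (\<exists>d. uea_tendsto (at z) (\<lambda>w. (1 / (w - z)) *\<^sub>C (f w - f z)) d)"

lemma uea_differentiableE:
  assumes "uea_differentiable z f"
  obtains d where "uea_tendsto (at z) (\<lambda>w. (1 / (w - z)) *\<^sub>C (f w - f z)) d"
  using assms by (auto simp: uea_differentiable_def)

lemma uea_differentiableI:
  "uea_tendsto (at z) (\<lambda>w. (1 / (w - z)) *\<^sub>C (f w - f z)) d \<Longrightarrow> uea_differentiable z f"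
  by (auto simp: uea_differentiable_def)

lemma uea_differentiable_imp_tendsto:
  assumes "uea_differentiable z f"
  shows "uea_tendsto (at z) f (f z)"
proof -
  obtain d where d: "uea_tendsto (at z) (\<lambda>w. (1 / (w - z)) *\<^sub>C (f w - f z)) d"
    using assms by (rule uea_differentiableE)
  have "((\<lambda>w. w - z) \<longlongrightarrow> 0) (at z)"
    by (rule LIM_offset_zero_cancel) (simp add: tendsto_ident_at)
  from uea_tendsto.add[OF uea_tendsto_const[of "at z" "f z"] uea_tendsto_scaleC[OF this d]]
  have "uea_tendsto (at z) (\<lambda>w. f z + (w - z) *\<^sub>C (1 / (w - z)) *\<^sub>C (f w - f z)) (f z)"
    by simp
  then show ?thesis
    by (rule uea_tendsto.cong) (auto simp: eventually_at_filter scaleC_scaleC scaleC_one)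
qed

lemma uea_differentiable_cong:
  assumes "uea_differentiable z f" "\<forall>\<^sub>F w in at z. f w = g w" "f z = g z"
  shows "uea_differentiable z g"
proof -
  obtain d where d: "uea_tendsto (at z) (\<lambda>w. (1 / (w - z)) *\<^sub>C (f w - f z)) d"
    using assms(1) by (rule uea_differentiableE)
  have "\<forall>\<^sub>F w in at z. (1 / (w - z)) *\<^sub>C (f w - f z) = (1 / (w - z)) *\<^sub>C (g w - g z)"
    using assms(2) by eventually_elim (simp add: assms(3))
  from uea_tendsto.cong[OF d this] show ?thesis
    by (rule uea_differentiableI)
qed

lemma uea_differentiable_const: "uea_differentiable z (\<lambda>_. a)"
proof (rule uea_differentiableI)
  show "uea_tendsto (at z) (\<lambda>w. (1 / (w - z)) *\<^sub>C (a - a)) 0"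
    by (simp add: uea_tendsto_const)
qed

lemma uea_differentiable_add:
  assumes "uea_differentiable z f" "uea_differentiable z g"
  shows "uea_differentiable z (\<lambda>w. f w + g w)"
proof -
  obtain d where d: "uea_tendsto (at z) (\<lambda>w. (1 / (w - z)) *\<^sub>C (f w - f z)) d"
    using assms(1) by (rule uea_differentiableE)
  obtain e where e: "uea_tendsto (at z) (\<lambda>w. (1 / (w - z)) *\<^sub>C (g w - g z)) e"
    using assms(2) by (rule uea_differentiableE)
  have "uea_tendsto (at z) (\<lambda>w. (1 / (w - z)) *\<^sub>C (f w + g w - (f z + g z))) (d + e)"
    using uea_tendsto.add[OF d e] by (simp add: add_diff_add scaleC_add_right)
  then show ?thesis by (rule uea_differentiableI)
qed

lemma uea_differentiable_mult:
  assumes "uea_differentiable z f" "uea_differentiable z g"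
  shows "uea_differentiable z (\<lambda>w. f w * g w)"
proof -
  obtain d where d: "uea_tendsto (at z) (\<lambda>w. (1 / (w - z)) *\<^sub>C (f w - f z)) d"
    using assms(1) by (rule uea_differentiableE)
  obtain e where e: "uea_tendsto (at z) (\<lambda>w. (1 / (w - z)) *\<^sub>C (g w - g z)) e"
    using assms(2) by (rule uea_differentiableE)
  have "uea_tendsto (at z) (\<lambda>w. (1 / (w - z)) *\<^sub>C (f w - f z) * g w +
      f z * (1 / (w - z)) *\<^sub>C (g w - g z)) (d * g z + f z * e)"
    by (intro uea_tendsto.add uea_tendsto.mul d e uea_tendsto_const
        uea_differentiable_imp_tendsto assms)
  then have "uea_tendsto (at z) (\<lambda>w. (1 / (w - z)) *\<^sub>C (f w * g w - f z * g z)) (d * g z + f z * e)"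
    by (simp add: uea_scaleC_mult_left uea_scaleC_mult_right algebra_simps flip: scaleC_add_right)
  then show ?thesis by (rule uea_differentiableI)
qed

lemma uea_differentiable_scalar:
  assumes "(c has_field_derivative c') (at z)"
  shows "uea_differentiable z (\<lambda>w. c w *\<^sub>C 1)"
proof -
  have "((\<lambda>w. (c w - c z) / (w - z)) \<longlongrightarrow> c') (at z)"
    using assms by (simp add: has_field_derivative_iff)
  from uea_tendsto.scal[OF this]
  have "uea_tendsto (at z) (\<lambda>w. (1 / (w - z)) *\<^sub>C (c w *\<^sub>C 1 - c z *\<^sub>C 1)) (c' *\<^sub>C 1)"
    by (simp add: scaleC_scaleC flip: scaleC_diff_left)
  then show ?thesis by (rule uea_differentiableI)
qed

lemma uea_differentiable_scaleC:
  assumes "(c has_field_derivative c') (at z)" "uea_differentiable z f"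
  shows "uea_differentiable z (\<lambda>w. c w *\<^sub>C f w)"
  using uea_differentiable_mult[OF uea_differentiable_scalar[OF assms(1)] assms(2)]
  by (simp add: uea_scaleC_mult_left)

lemma uea_differentiable_diff:
  assumes "uea_differentiable z f" "uea_differentiable z g"
  shows "uea_differentiable z (\<lambda>w. f w - g w)"
  using uea_differentiable_add[OF assms(1) uea_differentiable_scaleC[OF DERIV_const[of "-1"] assms(2)]]
  by (simp add: scaleC_minus_one)

text \<open>
  The difference quotient of \<open>1 / (u - w)\<close> in the parameter is \<open>1 / ((u - z) (u - w))\<close>, a family of
  the same kind.
\<close>

lemma uea_differentiable_Gen_over_linear:
  assumes h: "h = (\<lambda>_. 1) \<or> h \<in> mero_vanishing"
  shows "uea_differentiable z (\<lambda>w. Gen (pure_map (\<lambda>u. h u / (u - w)) v))"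
proof -
  define h' where "h' u = h u / (u - z)" for u
  have van: "(\<lambda>u. h u / (u - w)) \<in> mero_vanishing" for w
    using mero_tendsto_over_linear[OF h] by (auto simp: mero_tendsto_def)
  then have h': "h' = (\<lambda>_. 1) \<or> h' \<in> mero_vanishing"
    by (simp add: h'_def[abs_def])
  have "pure_map (\<lambda>u. h' u / (u - w)) v =
      (1 / (w - z)) *\<^sub>C (pure_map (\<lambda>u. h u / (u - w)) v + (-1) *\<^sub>C pure_map (\<lambda>u. h u / (u - z)) v)"
    if "w \<noteq> z" for w
  proof -
    have "(\<lambda>u. h' u / (u - w)) \<in> mero_vanishing"
      using mero_tendsto_over_linear[OF h'] by (auto simp: mero_tendsto_def)
    note l = represents_pure[OF this, of v]
    have r: "represents ((1 / (w - z)) *\<^sub>C (pure_map (\<lambda>u. h u / (u - w)) v +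
          (-1) *\<^sub>C pure_map (\<lambda>u. h u / (u - z)) v))
        (\<lambda>u. (1 / (w - z)) *\<^sub>C ((h u / (u - w)) *\<^sub>C v + (-1) *\<^sub>C (h u / (u - z)) *\<^sub>C v))"
      by (intro represents_scaleC represents_add represents_pure van)
    have "(h' u / (u - w)) *\<^sub>C v = (1 / (w - z)) *\<^sub>C ((h u / (u - w)) *\<^sub>C v + (-1) *\<^sub>C (h u / (u - z)) *\<^sub>C v)"
      if "u \<noteq> w" "u \<noteq> z" for u
    proof -
      have "h' u / (u - w) = 1 / (w - z) * (h u / (u - w) + (-1) * (h u / (u - z)))"
        using that \<open>w \<noteq> z\<close> by (simp add: h'_def divide_simps) (simp add: algebra_simps)
      then show ?thesis
        by (simp only: scaleC_scaleC flip: scaleC_add_left)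
    qed
    then have "{u. (h' u / (u - w)) *\<^sub>C v \<noteq>
        (1 / (w - z)) *\<^sub>C ((h u / (u - w)) *\<^sub>C v + (-1) *\<^sub>C (h u / (u - z)) *\<^sub>C v)} \<subseteq> {w, z}"
      by blast
    then show ?thesis
      using represents_eq_iff[OF l r] finite_subset by blast
  qed
  then have "(1 / (w - z)) *\<^sub>C (Gen (pure_map (\<lambda>u. h u / (u - w)) v) - Gen (pure_map (\<lambda>u. h u / (u - z)) v)) =
      Gen (pure_map (\<lambda>u. h' u / (u - w)) v)" if "w \<noteq> z" for w
    using that by (simp add: scaleC_minus_one Gen_scaleC Gen_diff)
  then have "\<forall>\<^sub>F w in at z. Gen (pure_map (\<lambda>u. h' u / (u - w)) v) =
      (1 / (w - z)) *\<^sub>C (Gen (pure_map (\<lambda>u. h u / (u - w)) v) - Gen (pure_map (\<lambda>u. h u / (u - z)) v))"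
    by (simp add: eventually_at_filter)
  from uea_tendsto.cong[OF uea_tendsto.gen[OF mero_tendsto_over_linear[OF h', of z]] this]
  show ?thesis by (rule uea_differentiableI)
qed

lemma uea_differentiable_Gen_eps: "uea_differentiable z (\<lambda>w. Gen (eps w v))"
  unfolding eps_def using uea_differentiable_Gen_over_linear[of "\<lambda>_. 1" z v] by simp

lemma uea_differentiable_Gen_lie_eps:
  fixes \<alpha> :: "'g::complex_lie_algebra gminus"
  shows "uea_differentiable z (\<lambda>w. Gen (lie (eps w v) \<alpha>))"
proof -
  have "uea_differentiable z (\<lambda>w. Gen (lie (eps w v) (abs_gminus f)))"
    if "f \<in> vec_fun mero_vanishing" for f :: "complex \<Rightarrow> 'g"
    using that
  proof (induction rule: vec_fun.induct)
    case (pure c v')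
    have "lie (eps w v) (abs_gminus (\<lambda>u. c u *\<^sub>C v')) = pure_map (\<lambda>u. c u / (u - w)) (lie v v')" for w
    proof (rule represents_unique)
      have "represents (abs_gminus (\<lambda>u. c u *\<^sub>C v')) (\<lambda>u. c u *\<^sub>C v')"
        using vec_fun.pure[OF pure] by (simp add: represents_def)
      from represents_lie[OF represents_eps this]
      show "represents (lie (eps w v) (abs_gminus (\<lambda>u. c u *\<^sub>C v'))) (\<lambda>u. (c u / (u - w)) *\<^sub>C lie v v')"
        by (simp add: lie_scaleC_left lie_scaleC_right scaleC_scaleC)
      show "represents (pure_map (\<lambda>u. c u / (u - w)) (lie v v')) (\<lambda>u. (c u / (u - w)) *\<^sub>C lie v v')"
        using mero_tendsto_over_linear[of c z] pure by (intro represents_pure) (simp add: mero_tendsto_def)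
    qed
    then show ?case
      using uea_differentiable_Gen_over_linear[of c z "lie v v'"] pure by simp
  next
    case (add f g)
    then have "abs_gminus (\<lambda>u. f u + g u) = abs_gminus f + abs_gminus g"
      by (simp add: plus_gminus.abs_eq mero_rel_refl)
    then show ?case
      using uea_differentiable_add[OF add.IH] by (simp add: lie_add_right Gen_add)
  qed
  then show ?thesis
    using ex_represents[of \<alpha>] by (auto simp: represents_def)
qed

text \<open>
  Derivative of the composition of a family of linear maps with a vector-valued function that is
  holomorphic near \<open>z\<close>.
\<close>

lemma uea_differentiable_compose_vec_fun:
  assumes f: "f \<in> vec_fun {c. c analytic_on {z}}"
    and K: "\<And>y. uea_differentiable z (\<lambda>w. K w y)"
    and lin: "\<forall>\<^sub>F w in nhds z. clinear (K w)"
  shows "uea_differentiable z (\<lambda>w. K w (f w))"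
  using f
proof (induction rule: vec_fun.induct)
  case (pure c v)
  then have "(c has_field_derivative deriv c z) (at z)"
    by (simp add: DERIV_deriv_iff_field_differentiable analytic_on_imp_differentiable_at)
  from uea_differentiable_scaleC[OF this K[of v]] show ?case
    by (rule uea_differentiable_cong)
      (use lin in \<open>auto simp: eventually_nhds_conv_at clinear_def elim: eventually_mono\<close>)
next
  case (add f g)
  from uea_differentiable_add[OF add.IH] show ?case
    by (rule uea_differentiable_cong)
      (use lin in \<open>auto simp: eventually_nhds_conv_at clinear_def elim: eventually_mono\<close>)
qed

lemma clinear_current:
  assumes "x \<in> U_reg {z}"
  shows "clinear (\<lambda>v. current z v x)"
  using assms by (simp add: clinear_def current_add_left current_scaleC_left)

lemma eventually_U_reg_point:
  assumes "x \<in> U_reg {z}"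
  shows "\<forall>\<^sub>F w in nhds z. x \<in> U_reg {w}"
proof -
  have "\<forall>\<^sub>F w in at z. x \<in> U_reg {w}"
    using eventually_U_reg[OF assms] by eventually_elim (rule U_reg_antimono[rotated], auto)
  then show ?thesis
    using assms by (simp add: eventually_nhds_conv_at)
qed

lemma uea_differentiable_iota:
  assumes "x \<in> U_reg {z}"
  shows "uea_differentiable z (\<lambda>w. iota w v x)"
proof -
  have "\<forall>v. uea_differentiable z (\<lambda>w. iota w v x)"
    using assms
  proof (induction rule: U_reg_word_induct)
    case one
    then show ?case by (simp add: iota_one uea_differentiable_const)
  next
    case (add x y)
    show ?case
    proof
      fix v
      have eq: "\<forall>\<^sub>F w in nhds z. iota w v x + iota w v y = iota w v (x + y)"
        using eventually_U_reg_point[OF add(1)] eventually_U_reg_point[OF add(2)]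
        by eventually_elim (simp add: iota_add)
      have "uea_differentiable z (\<lambda>w. iota w v x + iota w v y)"
        using add(3,4) by (intro uea_differentiable_add) auto
      then show "uea_differentiable z (\<lambda>w. iota w v (x + y))"
        by (rule uea_differentiable_cong) (use eq in \<open>auto simp: eventually_nhds_conv_at\<close>)
    qed
  next
    case (scaleC c x)
    show ?case
    proof
      fix v
      have eq: "\<forall>\<^sub>F w in nhds z. c *\<^sub>C iota w v x = iota w v (c *\<^sub>C x)"
        using eventually_U_reg_point[OF scaleC(1)] by eventually_elim (simp add: iota_scaleC)
      have "uea_differentiable z (\<lambda>w. c *\<^sub>C iota w v x)"
        using scaleC(2) by (intro uea_differentiable_scaleC[OF DERIV_const]) auto
      then show "uea_differentiable z (\<lambda>w. iota w v (c *\<^sub>C x))"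
        by (rule uea_differentiable_cong) (use eq in \<open>auto simp: eventually_nhds_conv_at\<close>)
    qed
  next
    case (word \<alpha> x)
    then have "regular_at z \<alpha>" by simp
    then obtain f where f: "represents \<alpha> f" "f \<in> vec_fun {c. c analytic_on {z}}"
      by (rule regular_atE)
    note x = eventually_U_reg_point[OF word(2)]
    show ?case
    proof
      fix v
      let ?rhs = "\<lambda>w. Gen \<alpha> * iota w v x - Gen (lie (eps w v) \<alpha>) * x
          - deriv (\<lambda>u. form v (f u)) w *\<^sub>C x + current w (lie v (f w)) x"
      \<comment> \<open>The defining relation at \<open>w\<close>, with the last two terms combined to a current.\<close>
      have eq: "\<forall>\<^sub>F w in nhds z. ?rhs w = iota w v (Gen \<alpha> * x)"
        using x eventually_vec_fun_analytic[OF f(2)]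
      proof eventually_elim
        case (elim w)
        then have "regular_rep w \<alpha> f" "regular_at w \<alpha>"
          using f(1) by (auto simp: regular_rep_iff intro: regular_atI)
        then show ?case
          using elim(1) by (simp add: iota_Gen_mult value_at_eq form_deriv_at_eq current_def)
      qed
      have "deriv (\<lambda>u. form v (f u)) analytic_on {z}"
        using vec_fun_form_const[OF fun_algebra_analytic f(2), of v] by (auto intro: analytic_deriv)
      then have "(deriv (\<lambda>u. form v (f u)) has_field_derivative deriv (deriv (\<lambda>u. form v (f u))) z) (at z)"
        by (simp add: DERIV_deriv_iff_field_differentiable analytic_on_imp_differentiable_at)
      note 3 = uea_differentiable_scaleC[OF this uea_differentiable_const[of z x]]
      have iota: "uea_differentiable z (\<lambda>w. iota w y x)" for y
        using word(3) by blast
      note 1 = uea_differentiable_mult[OF uea_differentiable_const[of z "Gen \<alpha>"] iota[of v]]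
      note 2 = uea_differentiable_mult[OF uea_differentiable_Gen_lie_eps[of z v \<alpha>]
          uea_differentiable_const[of z x]]
      have "uea_differentiable z (\<lambda>w. current w y x)" for y
        unfolding current_def epsilon_def
        by (rule uea_differentiable_add[OF uea_differentiable_mult[OF uea_differentiable_Gen_eps
                uea_differentiable_const] iota])
      moreover have "\<forall>\<^sub>F w in nhds z. clinear (\<lambda>y. current w y x)"
        using x by eventually_elim (rule clinear_current)
      ultimately have 4: "uea_differentiable z (\<lambda>w. current w (lie v (f w)) x)"
        by (rule uea_differentiable_compose_vec_fun[OF vec_fun_lie_const[OF f(2)]])
      have "uea_differentiable z ?rhs"
        by (rule uea_differentiable_add[OF uea_differentiable_diff[OF uea_differentiable_diff[OF 1 2] 3] 4])
      then show "uea_differentiable z (\<lambda>w. iota w v (Gen \<alpha> * x))"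
        by (rule uea_differentiable_cong) (use eq in \<open>auto simp: eventually_nhds_conv_at\<close>)
    qed
  qed
  then show ?thesis by blast
qed

section \<open>The operator product expansion\<close>

lemma iota_closed2: "x \<in> U_reg {z, w} \<Longrightarrow> iota z v x \<in> U_reg {z, w}"
  by (rule iota_closed) auto

text \<open>
  The singular terms all arise from commuting \<open>iota z2 v2\<close> past \<open>Gen (eps z1 v1)\<close>.
\<close>

lemma current_product:
  fixes v1 v2 :: "'g::metric_lie_algebra"
  assumes z: "z1 \<noteq> z2" and x: "x \<in> U_reg {z1, z2}"
  shows "current z2 v2 (current z1 v1 x) - (form v1 v2 / (z1 - z2)\<^sup>2) *\<^sub>C x
      - (1 / (z2 - z1)) *\<^sub>C current z1 (lie v2 v1) x =
    iota z2 v2 (iota z1 v1 x) + epsilon z2 v2 (epsilon z1 v1 x)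
      + epsilon z2 v2 (iota z1 v1 x) + epsilon z1 v1 (iota z2 v2 x)
      + (1 / (z2 - z1)) *\<^sub>C (iota z2 (lie v2 v1) x - iota z1 (lie v2 v1) x)"
proof -
  have x2: "x \<in> U_reg {z2}"
    using x by (rule U_reg_antimono[rotated]) auto
  have i: "iota z1 v1 x \<in> U_reg {z2}"
    using iota_closed2[OF x] by (rule U_reg_antimono[rotated]) auto
  have e: "Gen (eps z1 v1) * x \<in> U_reg {z2}"
    using x2 z by (auto intro!: U_reg_mult U_reg_Gen regular_at_eps)
  let ?l = "lie v2 v1"
  have "eps z2 ?l - eps z1 ?l = (z2 - z1) *\<^sub>C lie (eps z2 v2) (eps z1 v1)"
    using lie_eps_eps[of z2 z1 v2 v1] z by (simp add: scaleC_scaleC scaleC_one)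
  then have "(1 / (z2 - z1)) *\<^sub>C (eps z2 ?l - eps z1 ?l) = lie (eps z2 v2) (eps z1 v1)"
    using z by (simp add: scaleC_scaleC scaleC_one)
  then have lie: "Gen (lie (eps z2 v2) (eps z1 v1)) =
      (1 / (z2 - z1)) *\<^sub>C Gen (eps z2 ?l) - (1 / (z2 - z1)) *\<^sub>C Gen (eps z1 ?l)"
    by (metis Gen_diff Gen_scaleC scaleC_diff_right)
  have f: "form_deriv_at z2 v2 (eps z1 v1) = - (form v1 v2 / (z1 - z2)\<^sup>2)"
    using z by (simp add: form_deriv_at_eps form_sym[of v2] power2_commute[of z2])
  have "iota z2 v2 (Gen (eps z1 v1) * x) = Gen (eps z1 v1) * iota z2 v2 x
      + (form v1 v2 / (z1 - z2)\<^sup>2) *\<^sub>C x + (1 / (z2 - z1)) *\<^sub>C iota z2 ?l x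
      + (1 / (z2 - z1)) *\<^sub>C (Gen (eps z1 ?l) * x)"
    using z by (simp add: iota_Gen_mult[OF regular_at_eps[OF z] x2] lie f value_at_eps
        lie_scaleC_right iota_scaleC_left[OF x2] epsilon_def eps_scaleC Gen_scaleC
        uea_scaleC_mult_left scaleC_minus_left algebra_simps)
  moreover have "current z2 v2 (current z1 v1 x) = Gen (eps z2 v2) * (Gen (eps z1 v1) * x)
      + Gen (eps z2 v2) * iota z1 v1 x + iota z2 v2 (Gen (eps z1 v1) * x) + iota z2 v2 (iota z1 v1 x)"
    by (simp add: current_def epsilon_def iota_add[OF e i] iota_add[OF i e] algebra_simps)
  ultimately show ?thesis
    by (simp add: current_def epsilon_def scaleC_add_right scaleC_diff_right algebra_simps)
qed

theorem proposition11p3: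
  fixes v1 v2 :: "'g::metric_lie_algebra" and z1 :: complex
  shows "(\<forall>z2. z1 \<noteq> z2 \<longrightarrow> (\<forall>x \<in> U_reg {z1, z2}.
            current z1 v1 x \<in> U_reg {z2} \<and> current z2 v2 x \<in> U_reg {z1} \<and>
            current z1 v1 (current z2 v2 x) = current z2 v2 (current z1 v1 x))) \<and>
         (\<forall>x \<in> U_reg {z1}.
            (\<forall>\<^sub>F z2 in at z1. x \<in> U_reg {z1, z2}) \<and>
            (\<exists>d. iota_has_deriv z1 (lie v2 v1) x d) \<and>
            (\<forall>d. iota_has_deriv z1 (lie v2 v1) x d \<longrightarrow>
               uea_tendsto (at z1)
                 (\<lambda>z2. current z2 v2 (current z1 v1 x)
                       - (form v1 v2 / (z1 - z2)\<^sup>2) *\<^sub>C x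
                       - (1 / (z2 - z1)) *\<^sub>C current z1 (lie v2 v1) x)
                 (iota z1 v2 (iota z1 v1 x) + epsilon z1 v2 (epsilon z1 v1 x)
                  + epsilon z1 v2 (iota z1 v1 x) + epsilon z1 v1 (iota z1 v2 x) + d)))"
proof (intro conjI allI impI ballI)
  fix z2 :: complex and x :: "'g gminus uea"
  assume z: "z1 \<noteq> z2" and x: "x \<in> U_reg {z1, z2}"
  show "current z1 v1 x \<in> U_reg {z2}"
    by (rule current_closed2[OF z x])
  show "current z2 v2 x \<in> U_reg {z1}"
    using z x by (intro current_closed2) (auto simp: insert_commute)
  show "current z1 v1 (current z2 v2 x) = current z2 v2 (current z1 v1 x)"
    by (rule current_commute[OF z x])
next
  fix x :: "'g gminus uea" and d
  assume x: "x \<in> U_reg {z1}"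
  show ev: "\<forall>\<^sub>F z2 in at z1. x \<in> U_reg {z1, z2}"
    by (rule eventually_U_reg[OF x])
  show "\<exists>d. iota_has_deriv z1 (lie v2 v1) x d"
    using uea_differentiable_iota[OF x] by (simp add: uea_differentiable_def iota_has_deriv_def)
  assume d: "iota_has_deriv z1 (lie v2 v1) x d"
  have "uea_tendsto (at z1)
      (\<lambda>z2. iota z2 v2 (iota z1 v1 x) + epsilon z2 v2 (epsilon z1 v1 x)
        + epsilon z2 v2 (iota z1 v1 x) + epsilon z1 v1 (iota z2 v2 x)
        + (1 / (z2 - z1)) *\<^sub>C (iota z2 (lie v2 v1) x - iota z1 (lie v2 v1) x))
      (iota z1 v2 (iota z1 v1 x) + epsilon z1 v2 (epsilon z1 v1 x)
        + epsilon z1 v2 (iota z1 v1 x) + epsilon z1 v1 (iota z1 v2 x) + d)"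
    unfolding epsilon_def
    by (intro uea_tendsto.add uea_tendsto.mul uea_tendsto_const d[unfolded iota_has_deriv_def]
        uea_differentiable_imp_tendsto[of z1 "\<lambda>w. iota w v2 _"]
        uea_differentiable_imp_tendsto[of z1 "\<lambda>w. Gen (eps w v2)"]
        uea_differentiable_iota uea_differentiable_Gen_eps iota_closed_point x)
  moreover have "\<forall>\<^sub>F z2 in at z1. z2 \<noteq> z1"
    by (simp add: eventually_at_filter)
  with ev have "\<forall>\<^sub>F z2 in at z1.
      iota z2 v2 (iota z1 v1 x) + epsilon z2 v2 (epsilon z1 v1 x)
        + epsilon z2 v2 (iota z1 v1 x) + epsilon z1 v1 (iota z2 v2 x)
        + (1 / (z2 - z1)) *\<^sub>C (iota z2 (lie v2 v1) x - iota z1 (lie v2 v1) x) =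
      current z2 v2 (current z1 v1 x) - (form v1 v2 / (z1 - z2)\<^sup>2) *\<^sub>C x
        - (1 / (z2 - z1)) *\<^sub>C current z1 (lie v2 v1) x"
    by eventually_elim (rule current_product[symmetric], auto)
  ultimately show "uea_tendsto (at z1)
      (\<lambda>z2. current z2 v2 (current z1 v1 x) - (form v1 v2 / (z1 - z2)\<^sup>2) *\<^sub>C x
        - (1 / (z2 - z1)) *\<^sub>C current z1 (lie v2 v1) x)
      (iota z1 v2 (iota z1 v1 x) + epsilon z1 v2 (epsilon z1 v1 x)
        + epsilon z1 v2 (iota z1 v1 x) + epsilon z1 v1 (iota z1 v2 x) + d)"
    by (rule uea_tendsto.cong)
qed

end
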